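(* Let $k\ge1$ be a fixed integer. For each positive integer $n$, let $\lambda_n$ denote a partition of $n$ which maximizes the number of $k$-chains of subpartitions among all partitions of $n$, and let $s_k(\lambda_n)$ be the number of $k$-chains of subpartitions of $\lambda_n$. Then $$s_k(\lambda_n)=e^{k\pi\sqrt{2n/3}-o(\sqrt n)}\qquad\text{as }n\to\infty.$$ Furthermore, the rescaled boundary functions $f_{\lambda_n}:\mathbb R\to\mathbb R$ converge uniformly on $\mathbb R$ as $n\to\infty$ to $$f(x)=\frac{2\sqrt3}{\pi}\log\Big(2\cosh\Big(\frac{\pi}{2\sqrt3}x\Big)\Big).$$ Both conclusions hold whether the ordering in the definition of $k$-chains is taken to be strict or non-strict.
   Context: A partition of $n$ is a sequence $\lambda=(\lambda_1\ge\dots\ge\lambda_m)$ of positive integers with sum $n$. A subpartition of $\lambda$ is a partition $\mu=(\mu_1\ge\dots\ge\mu_\ell)$ (of some integer) with $\ell\le m$ and $\mu_i\le\lambda_i$ for all $i\le\ell$; the empty partition ($\ell=0$) and $\lambda$ itself are counted as subpartitions. A $k$-chain of subpartitions of $\lambda$ is a simply ordered collection $\mu^{(k)}\le\dots\le\mu^{(1)}$ of $k$ subpartitions of $\lambda$, where $\mu\le\nu$ means that $\mu$ is a subpartition of $\nu$; in the strict convention, consecutive members must be distinct, while in the non-strict convention equalities are allowed. Boundary function (Russian convention): draw the Young diagram of $\lambda$ in English convention (left-justified rows of unit boxes, $\lambda_1$ boxes on top, then $\lambda_2$ below, etc.), rotate it by $135^\circ$ and place it immediately adjacent to the graph of $x\mapsto|x|$,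 each box having unit side length. Explicitly, the box in row $i$ and column $j$ ($1\le j\le\lambda_i$) becomes the square $\{(\frac{s-t}{\sqrt2},\frac{s+t}{\sqrt2}): i-1\le s\le i,\ j-1\le t\le j\}$. Let $D_\lambda$ be the union of these squares and of the graph of $|x|$, and let $g_\lambda(x)=\max\{y:(x,y)\in D_\lambda\}$. For $\lambda$ a partition of $n$, the rescaled function is $f_\lambda(x)=n^{-1/2}g_\lambda(n^{1/2}x)$, so that $\int_{\mathbb R}(f_\lambda(x)-|x|)\,dx=1$. Here $o(\sqrt n)$ denotes a quantity $r_n$ with $r_n/\sqrt n\to0$ as $n\to\infty$. *)

theory Defs
  imports "HOL-Analysis.Analysis"
begin

definition is_partition :: "nat list \<Rightarrow> bool" where
  "is_partition xs \<longleftrightarrow> sorted_wrt (\<ge>) xs \<and> (\<forall>x\<in>set xs. 0 < x)"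

definition partition_of :: "nat \<Rightarrow> nat list \<Rightarrow> bool" where
  "partition_of n xs \<longleftrightarrow> is_partition xs \<and> sum_list xs = n"

definition subpartition :: "nat list \<Rightarrow> nat list \<Rightarrow> bool" where
  "subpartition \<mu> \<nu> \<longleftrightarrow>
     is_partition \<mu> \<and> length \<mu> \<le> length \<nu> \<and> (\<forall>i<length \<mu>. \<mu> ! i \<le> \<nu> ! i)"

definition strict_subpartition :: "nat list \<Rightarrow> nat list \<Rightarrow> bool" where
  "strict_subpartition \<mu> \<nu> \<longleftrightarrow> subpartition \<mu> \<nu> \<and> \<mu> \<noteq> \<nu>"

text \<open>
  A chain is listed from its largest member to its smallest. The parameter \<open>le\<close> is either
  \<open>subpartition\<close> (non-strict convention) or \<open>strict_subpartition\<close> (strict convention). Both are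
  transitive on partitions, so it makes no difference that \<open>sorted_wrt\<close> compares all pairs rather
  than just consecutive ones.
\<close>

definition chains :: "(nat list \<Rightarrow> nat list \<Rightarrow> bool) \<Rightarrow> nat \<Rightarrow> nat list \<Rightarrow> nat list list set" where
  "chains le k \<nu> =
     {c. length c = k \<and> (\<forall>\<mu>\<in>set c. subpartition \<mu> \<nu>) \<and> sorted_wrt (\<lambda>\<mu> \<mu>'. le \<mu>' \<mu>) c}"

definition num_chains :: "(nat list \<Rightarrow> nat list \<Rightarrow> bool) \<Rightarrow> nat \<Rightarrow> nat list \<Rightarrow> nat" where
  "num_chains le k \<nu> = card (chains le k \<nu>)"

text \<open>The cardinality above is never that of an infinite set.\<close>

lemma finite_chains: "finite (chains le k \<nu>)"
proof -
  let ?S = "{\<mu>. set \<mu> \<subseteq> {..Max (set \<nu>)} \<and> length \<mu> \<le> length \<nu>}"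
  have "\<mu> \<in> ?S" if "subpartition \<mu> \<nu>" for \<mu>
  proof -
    have "\<mu> ! i \<le> Max (set \<nu>)" if i: "i < length \<mu>" for i
    proof -
      have "\<mu> ! i \<le> \<nu> ! i" "\<nu> ! i \<in> set \<nu>"
        using \<open>subpartition \<mu> \<nu>\<close> i by (auto simp: subpartition_def)
      then show ?thesis
        by (meson List.finite_set Max_ge order_trans)
    qed
    then show ?thesis
      using that by (auto simp: subpartition_def in_set_conv_nth)
  qed
  then have "chains le k \<nu> \<subseteq> {c. set c \<subseteq> ?S \<and> length c = k}"
    by (auto simp: chains_def)
  moreover have "finite {c. set c \<subseteq> ?S \<and> length c = k}"
    by (intro finite_lists_length_eq finite_lists_length_le finite_atMost)
  ultimately show ?thesis
    by (rule finite_subset)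
qed

text \<open>Rows and columns of the diagram are numbered from 1, whereas list positions start at 0.\<close>

definition russian_box :: "nat \<Rightarrow> nat \<Rightarrow> (real \<times> real) set" where
  "russian_box i j =
     {((s - t) / sqrt 2, (s + t) / sqrt 2) | s t.
        real i - 1 \<le> s \<and> s \<le> real i \<and> real j - 1 \<le> t \<and> t \<le> real j}"

definition russian_diagram :: "nat list \<Rightarrow> (real \<times> real) set" where
  "russian_diagram \<nu> =
     (\<Union>i\<in>{1..length \<nu>}. \<Union>j\<in>{1..\<nu> ! (i - 1)}. russian_box i j) \<union> {(x, \<bar>x\<bar>) | x. True}"

definition boundary :: "nat list \<Rightarrow> real \<Rightarrow> real" where
  "boundary \<nu> x = (GREATEST y. (x, y) \<in> russian_diagram \<nu>)"

text \<open>The maximum in the definition of \<open>boundary\<close> is attained.\<close>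

lemma boundary_greatest:
  "(x, boundary \<nu> x) \<in> russian_diagram \<nu>"
  "(x, y) \<in> russian_diagram \<nu> \<Longrightarrow> y \<le> boundary \<nu> x"
proof -
  have box: "compact {y. (x, y) \<in> russian_box i j}" for i j
  proof -
    have "{y. (x, y) \<in> russian_box i j} =
        {y. real i - 1 \<le> (y + x) / sqrt 2 \<and> (y + x) / sqrt 2 \<le> real i \<and>
            real j - 1 \<le> (y - x) / sqrt 2 \<and> (y - x) / sqrt 2 \<le> real j}" (is "?L = ?R")
    proof (intro subset_antisym subsetI)
      fix y assume "y \<in> ?L"
      then obtain s t where st: "x = (s - t) / sqrt 2" "y = (s + t) / sqrt 2"
        "real i - 1 \<le> s" "s \<le> real i" "real j - 1 \<le> t" "t \<le> real j"
        by (auto simp: russian_box_def)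
      have "(y + x) / sqrt 2 = s" "(y - x) / sqrt 2 = t"
        unfolding st(1,2) by (auto simp: field_simps)
      then show "y \<in> ?R" using st by simp
    next
      fix y assume "y \<in> ?R"
      moreover have "x = ((y + x) / sqrt 2 - (y - x) / sqrt 2) / sqrt 2"
        "y = ((y + x) / sqrt 2 + (y - x) / sqrt 2) / sqrt 2"
        by (auto simp: field_simps)
      ultimately show "y \<in> ?L" unfolding russian_box_def by blast
    qed
    also have "\<dots> = {sqrt 2 * (real i - 1) - x .. sqrt 2 * real i - x} \<inter>
                    {sqrt 2 * (real j - 1) + x .. sqrt 2 * real j + x}"
      by (auto simp: field_simps)
    finally show ?thesis by (simp add: compact_Int)
  qed
  let ?Y = "{y. (x, y) \<in> russian_diagram \<nu>}"
  have "?Y = (\<Union>i\<in>{1..length \<nu>}. \<Union>j\<in>{1..\<nu> ! (i - 1)}. {y. (x, y) \<in> russian_box i j})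
               \<union> {\<bar>x\<bar>}"
    by (auto simp: russian_diagram_def)
  also have "compact \<dots>"
    by (intro compact_Un compact_UN box) auto
  finally have "compact ?Y" .
  moreover have "?Y \<noteq> {}"
    by (auto simp: russian_diagram_def)
  ultimately obtain m where m: "m \<in> ?Y" "\<And>y. y \<in> ?Y \<Longrightarrow> y \<le> m"
    using compact_attains_sup[of ?Y] by blast
  then have "boundary \<nu> x = m"
    unfolding boundary_def by (intro Greatest_equality) auto
  with m show "(x, boundary \<nu> x) \<in> russian_diagram \<nu>"
    "(x, y) \<in> russian_diagram \<nu> \<Longrightarrow> y \<le> boundary \<nu> x"
    by auto
qed

definition rescaled_boundary :: "nat list \<Rightarrow> real \<Rightarrow> real" where
  "rescaled_boundary \<nu> x =
     boundary \<nu> (sqrt (real (sum_list \<nu>)) * x) / sqrt (real (sum_list \<nu>))"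

end

theory Submission
  imports Defs "HOL-Real_Asymp.Real_Asymp"
begin

text \<open>
  Rotate the picture back and measure lengths in units of \<open>T = sqrt (6 n) / pi\<close>, so that diagrams with
  \<open>n\<close> boxes have area \<open>pi\<^sup>2 / 6\<close>. The limit shape becomes the region below
  \<open>ell v = - ln (1 - exp (- v))\<close>, that is, below the curve \<open>exp (- u) + exp (- v) = 1\<close>, which has the same
  area. The number to be matched is \<open>pi * sqrt (2 n / 3) = pi\<^sup>2 / 3 * T\<close>, twice the area times \<open>T\<close>.

  \<^bold>\<open>Upper bound.\<close> Subpartitions of a partition of \<open>n\<close> have size at most \<open>n\<close>. Weighting them by
  \<open>exp (- size / T)\<close> and summing over all partitions by Euler's product shows that there are at most
  \<open>exp (pi\<^sup>2 / 3 * T)\<close> of them (\<open>ln_card_subpartitions_le\<close>), and a \<open>k\<close>-chain is a \<open>k\<close>-tuple of subpartitions. If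
  moreover the ambient diagram misses a fixed point \<open>(u, v)\<close> strictly below the curve, then its
  subpartitions have fewer large parts than is typical, and an additional weight on the number of large
  parts improves the bound by a factor exponential in \<open>T\<close> (\<open>few_subpartitions_if_below_curve\<close>).

  \<^bold>\<open>Lower bound.\<close> Put a fine staircase along the curve and consider the partitions whose boundary
  passes through all corners of the staircase. Between corners the boundary is an arbitrary lattice path,
  counted by a binomial coefficient, and the logarithms of these coefficients add up to nearly twice the
  area below the curve (\<open>path_entropy_of_curve_step\<close>). Such partitions lie in a corridor whose width is
  the mesh width; moving \<open>k\<close> copies of the corridor side by side turns arbitrary \<open>k\<close>-tuples into strict
  chains (\<open>num_chains_ge_power\<close>) at a cost in area that vanishes with the mesh. Hence some partition of
  \<open>n\<close>, and therefore the maximizing one, has at least \<open>exp (k * (pi\<^sup>2 / 3 - \<epsilon>) * T)\<close> chains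
  (\<open>eventually_many_chains\<close>).

  \<^bold>\<open>Shape.\<close> Comparing the two bounds, the maximizing diagram eventually contains every fixed point
  strictly below the curve. Since the areas agree, the symmetric difference with the limit region has
  area tending to 0 (\<open>deviation_tendsto_0\<close>), and because both boundaries are monotone this area controls
  the square of the distance between them, uniformly (\<open>boundary_close_to_limit_curve\<close>).
\<close>

section \<open>The curve \<open>exp (- u) + exp (- v) = 1\<close>\<close>

text \<open>
  The graph of \<open>ell\<close> is the curve \<open>exp (- u) + exp (- v) = 1\<close>, the boundary of a typical
  large partition when rows are counted along one axis and row lengths along the other. The region
  below it is symmetric, which is why \<open>ell\<close> is its own inverse.
\<close>

definition ell :: "real \<Rightarrow> real" where
  "ell v = - ln (1 - exp (- v))"

lemma ell_pos: "0 < v \<Longrightarrow> 0 < ell v"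
  by (simp add: ell_def)

lemma ell_antimono: "0 < u \<Longrightarrow> u \<le> v \<Longrightarrow> ell v \<le> ell u"
  by (simp add: ell_def)

lemma ell_strict_antimono: "0 < u \<Longrightarrow> u < v \<Longrightarrow> ell v < ell u"
  by (simp add: ell_def)

lemma ell_ell: "0 < v \<Longrightarrow> ell (ell v) = v"
  by (simp add: ell_def)

lemma ell_measurable [measurable]: "ell \<in> borel_measurable borel"
  unfolding ell_def by measurable

lemma DERIV_ell: "0 < v \<Longrightarrow> (ell has_real_derivative - 1 / (exp v - 1)) (at v)"
  unfolding ell_def
  by (rule derivative_eq_intros refl | simp)+ (simp add: exp_minus field_simps)

text \<open>
  The mean value theorem, with the slope of \<open>ell\<close> at \<open>\<xi>\<close> written through \<open>exp \<xi>\<close>: this one identity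
  serves both bounds on the number of subpartitions, since \<open>1 / (exp \<xi> - 1)\<close> is at the same time the
  mean of a geometric distribution and the slope of the curve.
\<close>

lemma ell_difference:
  assumes "0 < u" "u < v"
  obtains \<xi> where "u < \<xi>" "\<xi> < v" "ell u - ell v = (v - u) / (exp \<xi> - 1)"
proof -
  have "\<exists>z>u. z < v \<and> ell v - ell u = (v - u) * (- 1 / (exp z - 1))"
    using assms by (intro MVT2 DERIV_ell) auto
  then obtain z where "z > u" "z < v" "ell v - ell u = (v - u) * (- 1 / (exp z - 1))" by blast
  then show ?thesis by (intro that[of z]) (auto simp: field_simps)
qed

lemma ell_sums:
  assumes "0 < v"
  shows "(\<lambda>m. exp (- (real (Suc m) * v)) / real (Suc m)) sums ell v"
proof -
  have "(\<lambda>m. - ((- (- exp (- v))) ^ m) / of_nat m) sums ln (1 + - exp (- v))"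
    using assms by (intro ln_series') auto
  then have "(\<lambda>m. - (- ((- (- exp (- v))) ^ m) / of_nat m)) sums (- ln (1 + - exp (- v)))"
    by (rule sums_minus)
  then have "(\<lambda>m. exp (- v) ^ m / real m) sums ell v"
    by (simp add: ell_def)
  then have "(\<lambda>m. exp (- v) ^ Suc m / real (Suc m)) sums ell v"
    by (subst sums_Suc_iff) simp
  moreover have "exp (- v) ^ m = exp (- (real m * v))" for m
    by (metis exp_of_nat_mult mult_minus_right)
  ultimately show ?thesis by (simp only:)
qed

text \<open>
  Integrating \<open>ell v = (\<Sum>m\<ge>1. exp (- m v) / m)\<close> term by term gives \<open>\<Sum>m\<ge>1. 1 / m\<^sup>2\<close>.
\<close>

lemma has_integral_ell:
  "set_integrable lborel {0<..} ell" "(LINT v:{0<..}|lborel. ell v) = pi\<^sup>2 / 6"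
proof -
  define g where "g m v = indicator {0<..} v * (exp (- (real (Suc m) * v)) / real (Suc m))" for m and v :: real
  have g_int: "(\<integral>\<^sup>+ v. ennreal (g m v) \<partial>lborel) = ennreal (1 / (real (Suc m))\<^sup>2)" for m
  proof -
    have "((\<lambda>v. exp (- real (Suc m) * v)) has_integral exp (- real (Suc m) * 0) / real (Suc m)) {0..}"
      by (rule has_integral_exp_minus_to_infinity) simp
    from has_integral_divide[OF this, of "real (Suc m)"]
    have "((\<lambda>v. exp (- (real (Suc m) * v)) / real (Suc m)) has_integral 1 / (real (Suc m))\<^sup>2) {0..}"
      by (simp add: power2_eq_square mult_minus_left del: of_nat_Suc minus_mult_left)
    then have "(\<integral>\<^sup>+ v. ennreal (indicator {0..} v * (exp (- (real (Suc m) * v)) / real (Suc m))) \<partial>lborel)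
         = ennreal (1 / (real (Suc m))\<^sup>2)"
      by (intro nn_integral_has_integral_lebesgue) auto
    also have "(\<integral>\<^sup>+ v. ennreal (indicator {0..} v * (exp (- (real (Suc m) * v)) / real (Suc m))) \<partial>lborel)
       = (\<integral>\<^sup>+ v. ennreal (g m v) \<partial>lborel)"
      by (intro nn_integral_cong_AE AE_I[where N = "{0}"]) (auto simp: g_def indicator_def)
    finally show ?thesis .
  qed
  have sums: "(\<lambda>m. g m v) sums (indicator {0<..} v * ell v)" for v
    unfolding g_def using ell_sums[of v] by (auto simp: indicator_def)
  have nonneg: "0 \<le> g m v" for m v by (simp add: g_def)
  have "(\<integral>\<^sup>+ v. ennreal (indicator {0<..} v * ell v) \<partial>lborel) = (\<integral>\<^sup>+ v. (\<Sum>m. ennreal (g m v)) \<partial>lborel)"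
    by (intro nn_integral_cong suminf_ennreal_eq[symmetric] nonneg sums)
  also have "\<dots> = (\<Sum>m. \<integral>\<^sup>+ v. ennreal (g m v) \<partial>lborel)"
    by (rule nn_integral_suminf) (simp add: g_def)
  also have "\<dots> = (\<Sum>m. ennreal (1 / (real (Suc m))\<^sup>2))"
    by (simp add: g_int)
  also have "\<dots> = ennreal (pi\<^sup>2 / 6)"
    using inverse_squares_sums by (intro suminf_ennreal_eq) (simp_all add: add.commute)
  finally have nn: "(\<integral>\<^sup>+ v. ennreal (indicator {0<..} v * ell v) \<partial>lborel) = ennreal (pi\<^sup>2 / 6)" .
  have pos: "0 \<le> indicator {0<..} v * ell v" for v
    using ell_pos[of v] by (auto simp: indicator_def)
  have "has_bochner_integral lborel (\<lambda>v. indicator {0<..} v * ell v) (pi\<^sup>2 / 6)"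
    using nn pos by (intro has_bochner_integral_nn_integral) auto
  then show "set_integrable lborel {0<..} ell" "(LINT v:{0<..}|lborel. ell v) = pi\<^sup>2 / 6"
    by (auto simp: set_integrable_def set_lebesgue_integral_def has_bochner_integral_iff)
qed

definition area :: "real \<Rightarrow> real \<Rightarrow> real" where
  "area a b = (LINT v:{a<..b}|lborel. ell v)"

lemma ell_integrable_on: "0 \<le> a \<Longrightarrow> set_integrable lborel {a<..b} ell"
  by (rule set_integrable_subset[OF has_integral_ell(1)]) auto

lemma area_nonneg: "0 \<le> a \<Longrightarrow> 0 \<le> area a b"
  unfolding area_def set_lebesgue_integral_def
  by (intro integral_nonneg_AE) (auto simp: indicator_def intro!: less_imp_le[OF ell_pos])

lemma area_le: "0 \<le> a \<Longrightarrow> area a b \<le> pi\<^sup>2 / 6"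
  unfolding area_def has_integral_ell(2)[symmetric] set_lebesgue_integral_def
  using ell_integrable_on[of a b] has_integral_ell(1) unfolding set_integrable_def
  by (intro integral_mono) (auto simp: indicator_def intro: less_imp_le[OF ell_pos])

lemma area_add:
  assumes "0 \<le> a" "a \<le> b" "b \<le> c"
  shows "area a c = area a b + area b c"
proof -
  have "{a<..c} = {a<..b} \<union> {b<..c}" using assms by auto
  then show ?thesis unfolding area_def
    using assms by (simp add: set_integral_Un ell_integrable_on)
qed

lemma area_le_left:
  assumes "0 < a" "a \<le> b"
  shows "area a b \<le> (b - a) * ell a"
proof -
  have "area a b \<le> (LINT v:{a<..b}|lborel. ell a)"
    unfolding area_def using assms
    by (intro set_integral_mono ell_integrable_on) (auto intro: ell_antimono simp: set_integrable_def)
  then show ?thesis using assms by (simp add: set_lebesgue_integral_def)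
qed

lemma area_ge_right:
  assumes "0 \<le> a" "a \<le> b"
  shows "(b - a) * ell b \<le> area a b"
proof -
  have "(LINT v:{a<..b}|lborel. ell b) \<le> area a b"
    unfolding area_def using assms
    by (intro set_integral_mono ell_integrable_on) (auto intro: ell_antimono simp: set_integrable_def)
  then show ?thesis using assms by (simp add: set_lebesgue_integral_def)
qed

text \<open>
  Since \<open>ell\<close> has no elementary antiderivative, sums of its values are compared with areas under the
  curve instead of being evaluated.
\<close>

lemma riemann_sum_le_area:
  assumes "0 \<le> a" "0 < h"
  shows "h * (\<Sum>i<m. ell (a + real (Suc i) * h)) \<le> area a (a + real m * h)"
proof (induction m)
  case (Suc m)
  have "area a (a + real (Suc m) * h) = area a (a + real m * h) + area (a + real m * h) (a + real (Suc m) * h)"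
    using assms by (intro area_add) (auto simp: algebra_simps)
  moreover have "h * ell (a + real (Suc m) * h) \<le> area (a + real m * h) (a + real (Suc m) * h)"
    using area_ge_right[of "a + real m * h" "a + real (Suc m) * h"] assms by (simp add: algebra_simps)
  ultimately show ?case using Suc by (simp add: algebra_simps)
qed (use area_nonneg[of a a] assms in auto)

lemma riemann_sum_ge_area:
  assumes "0 < a" "0 < h"
  shows "area a (a + real m * h) \<le> h * (\<Sum>i<m. ell (a + real i * h))"
proof (induction m)
  case (Suc m)
  have "area a (a + real (Suc m) * h) = area a (a + real m * h) + area (a + real m * h) (a + real (Suc m) * h)"
    using assms by (intro area_add) (auto simp: algebra_simps)
  moreover have "0 < a + real m * h" using assms by (simp add: add_pos_nonneg)
  then have "area (a + real m * h) (a + real (Suc m) * h) \<le> h * ell (a + real m * h)"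
    using area_le_left[of "a + real m * h" "a + real (Suc m) * h"] assms by (simp add: algebra_simps)
  ultimately show ?case using Suc by (simp add: algebra_simps)
qed (simp add: area_def set_lebesgue_integral_def)

lemma area_tendsto:
  assumes "a \<longlonglongrightarrow> 0" "\<And>j. 0 \<le> a j" "filterlim b at_top sequentially"
  shows "(\<lambda>j. area (a j) (b j)) \<longlonglongrightarrow> pi\<^sup>2 / 6"
  unfolding area_def has_integral_ell(2)[symmetric] set_lebesgue_integral_def
proof (rule integral_dominated_convergence[where w = "\<lambda>v. indicator {0<..} v *\<^sub>R ell v"])
  show "AE v in lborel. (\<lambda>j. indicat_real {a j<..b j} v *\<^sub>R ell v) \<longlonglongrightarrow> indicat_real {0<..} v *\<^sub>R ell v"
  proof (intro AE_I2 tendsto_eventually)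
    fix v :: real
    show "\<forall>\<^sub>F j in sequentially. indicat_real {a j<..b j} v *\<^sub>R ell v = indicat_real {0<..} v *\<^sub>R ell v"
    proof (cases "0 < v")
      case True
      with assms(1) have "\<forall>\<^sub>F j in sequentially. a j < v" by (rule order_tendstoD)
      moreover have "\<forall>\<^sub>F j in sequentially. v \<le> b j"
        using assms(3) by (simp add: filterlim_at_top)
      ultimately show ?thesis by eventually_elim (use True in auto)
    next
      case False
      with assms(2) have "v \<notin> {a j<..b j}" for j by (smt (verit) greaterThanAtMost_iff)
      with False show ?thesis by simp
    qed
  qed
  show "AE v in lborel. norm (indicat_real {a j<..b j} v *\<^sub>R ell v) \<le> indicat_real {0<..} v *\<^sub>R ell v" for j
    using assms(2)[of j] by (intro AE_I2) (auto simp: indicator_def abs_of_pos ell_pos less_imp_le)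
qed (use has_integral_ell(1) in \<open>auto simp: set_integrable_def\<close>)

section \<open>Upper bound by Euler's product\<close>

text \<open>
  With lengths measured in units of \<open>scale n\<close>, a diagram with \<open>n\<close> boxes has area \<open>pi\<^sup>2 / 6\<close>, exactly
  the area below \<open>ell\<close>. Weighting partitions \<open>\<mu>\<close> by \<open>exp (- |\<mu>| / scale n)\<close> is what makes a random
  partition have size about \<open>n\<close>.
\<close>

definition scale :: "nat \<Rightarrow> real" where
  "scale n = sqrt (6 * real n) / pi"

lemma scale_pos: "1 \<le> n \<Longrightarrow> 0 < scale n"
  by (simp add: scale_def)

lemma scale_square: "(scale n)\<^sup>2 * (pi\<^sup>2 / 6) = real n"
  by (simp add: scale_def power_divide)

lemma scale_at_top: "filterlim scale at_top sequentially"
  unfolding scale_def by real_asymp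

definition subpartitions :: "nat list \<Rightarrow> nat list set" where
  "subpartitions \<nu> = {\<mu>. subpartition \<mu> \<nu>}"

lemma finite_subpartitions: "finite (subpartitions \<nu>)"
proof -
  have "(\<lambda>\<mu>. [\<mu>]) ` subpartitions \<nu> \<subseteq> chains subpartition 1 \<nu>"
    by (auto simp: chains_def subpartitions_def)
  then have "finite ((\<lambda>\<mu>. [\<mu>]) ` subpartitions \<nu>)"
    using finite_chains by (rule finite_subset)
  then show ?thesis
    by (rule finite_imageD) (auto simp: inj_on_def)
qed

lemma subpartitions_sum_list:
  assumes "subpartition \<mu> \<nu>"
  shows "sum_list \<mu> \<le> sum_list \<nu>"
proof -
  have "sum_list \<mu> \<le> (\<Sum>i<length \<mu>. \<nu> ! i)"
    unfolding sum_list_sum_nth atLeast0LessThan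
    using assms by (intro sum_mono) (auto simp: subpartition_def)
  also have "\<dots> \<le> sum_list \<nu>"
    unfolding sum_list_sum_nth atLeast0LessThan
    using assms by (intro sum_mono2) (auto simp: subpartition_def)
  finally show ?thesis .
qed

lemma subpartitions_filter:
  assumes "subpartition \<mu> \<nu>"
  shows "length (filter ((\<le>) b) \<mu>) \<le> length (filter ((\<le>) b) \<nu>)"
  unfolding length_filter_conv_card using assms
  by (intro card_mono) (auto simp: subpartition_def intro: order_trans)

lemma partition_eqI:
  assumes "is_partition xs" "is_partition ys" "\<And>j. count_list xs j = count_list ys j"
  shows "xs = ys"
proof -
  have "mset (rev xs) = mset (rev ys)"
    using assms(3) by (auto simp: multiset_eq_iff count_mset)
  moreover have "sorted (rev xs)" "sorted (rev ys)"
    using assms(1,2) by (auto simp: is_partition_def sorted_wrt_rev)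
  ultimately have "rev xs = rev ys"
    by (metis properties_for_sort)
  then show ?thesis by simp
qed

lemma prod_list_map_eq_prod_count:
  fixes x :: "'a \<Rightarrow> 'b::comm_monoid_mult"
  assumes "finite X" "set xs \<subseteq> X"
  shows "prod_list (map x xs) = (\<Prod>j\<in>X. x j ^ count_list xs j)"
  using assms(2)
proof (induction xs)
  case (Cons a xs)
  have "(\<Prod>j\<in>X. x j ^ count_list (a # xs) j) = (\<Prod>j\<in>X. (if j = a then x j else 1) * x j ^ count_list xs j)"
    by (intro prod.cong) auto
  also have "\<dots> = x a * (\<Prod>j\<in>X. x j ^ count_list xs j)"
    using Cons.prems assms(1) by (simp add: prod.distrib prod.delta)
  finally show ?case using Cons by simp
qed simp

text \<open>
  Euler's product: a partition is determined by the multiplicities of its parts, and the weight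
  factors over the part sizes, so the sum over all partitions with parts in \<open>{1..n}\<close> is the product
  of geometric series.
\<close>

lemma sum_partition_weights_le:
  fixes x :: "nat \<Rightarrow> real"
  assumes F: "finite F" "\<And>\<mu>. \<mu> \<in> F \<Longrightarrow> is_partition \<mu>" "\<And>\<mu>. \<mu> \<in> F \<Longrightarrow> set \<mu> \<subseteq> {1..n}"
    and x: "\<And>j. j \<in> {1..n} \<Longrightarrow> 0 \<le> x j \<and> x j < 1"
  shows "(\<Sum>\<mu>\<in>F. prod_list (map x \<mu>)) \<le> (\<Prod>j=1..n. 1 / (1 - x j))"
proof -
  define K where "K = Max (length ` F)"
  have K: "length \<mu> \<le> K" if "\<mu> \<in> F" for \<mu>
    using that F(1) by (simp add: K_def)
  define mult where "mult \<mu> = restrict (count_list \<mu>) {1..n}" for \<mu> :: "nat list"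
  have inj: "inj_on mult F"
  proof (rule inj_onI)
    fix \<mu> \<nu> assume *: "\<mu> \<in> F" "\<nu> \<in> F" "mult \<mu> = mult \<nu>"
    show "\<mu> = \<nu>"
    proof (rule partition_eqI)
      fix j show "count_list \<mu> j = count_list \<nu> j"
      proof (cases "j \<in> {1..n}")
        case True
        then show ?thesis using fun_cong[OF *(3), of j] by (simp add: mult_def)
      next
        case False
        then have "j \<notin> set \<mu>" "j \<notin> set \<nu>" using F(3) *(1,2) by blast+
        then show ?thesis by (simp add: count_list_0_iff)
      qed
    qed (use F(2) * in auto)
  qed
  have "(\<Sum>\<mu>\<in>F. prod_list (map x \<mu>)) = (\<Sum>\<mu>\<in>F. \<Prod>j=1..n. x j ^ mult \<mu> j)"
    using F(3) by (intro sum.cong refl)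
      (simp add: mult_def prod_list_map_eq_prod_count[where X = "{1..n}"])
  also have "\<dots> = (\<Sum>g\<in>mult ` F. \<Prod>j=1..n. x j ^ g j)"
    by (simp add: sum.reindex[OF inj])
  also have "\<dots> \<le> (\<Sum>g\<in>PiE {1..n} (\<lambda>_. {..K}). \<Prod>j=1..n. x j ^ g j)"
  proof (rule sum_mono2)
    show "mult ` F \<subseteq> PiE {1..n} (\<lambda>_. {..K})"
      by (auto simp: mult_def intro!: order_trans[OF count_le_length K])
    show "finite (PiE {1..n} (\<lambda>_. {..K}))" by (intro finite_PiE) auto
    show "0 \<le> (\<Prod>j=1..n. x j ^ g j)" for g
      using x by (intro prod_nonneg) auto
  qed
  also have "\<dots> = (\<Prod>j=1..n. \<Sum>m\<le>K. x j ^ m)"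
    by (rule prod_sum_PiE[symmetric]) auto
  also have "\<dots> \<le> (\<Prod>j=1..n. 1 / (1 - x j))"
  proof (intro prod_mono conjI)
    fix j assume j: "j \<in> {1..n}"
    then show "0 \<le> (\<Sum>m\<le>K. x j ^ m)" using x by (intro sum_nonneg) auto
    have "(\<Sum>m\<le>K. x j ^ m) = (1 - x j ^ Suc K) / (1 - x j)"
      using x[OF j] by (simp add: sum_gp0)
    also have "\<dots> \<le> 1 / (1 - x j)"
      using x[OF j] by (intro divide_right_mono) auto
    finally show "(\<Sum>m\<le>K. x j ^ m) \<le> 1 / (1 - x j)" .
  qed
  finally show ?thesis .
qed

text \<open>
  Exponential Markov inequality. Every subpartition has size at most \<open>n\<close> and at most \<open>a\<close> parts of size
  at least \<open>b\<close>, so its weight \<open>q ^ size * z ^ (number of parts \<ge> b)\<close> is at least \<open>q ^ n * z ^ a\<close>.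
\<close>

lemma card_subpartitions_weighted_le:
  assumes \<nu>: "partition_of n \<nu>" and q: "0 < q" "q < 1" and z: "0 < z" "z \<le> 1"
    and a: "length (filter ((\<le>) b) \<nu>) \<le> a"
  shows "real (card (subpartitions \<nu>)) * (q ^ n * z ^ a) \<le> (\<Prod>j=1..n. 1 / (1 - q ^ j * (if b \<le> j then z else 1)))"
proof -
  define x where "x j = q ^ j * (if b \<le> j then z else 1)" for j :: nat
  have x_list: "prod_list (map x \<mu>) = q ^ sum_list \<mu> * z ^ length (filter ((\<le>) b) \<mu>)" for \<mu>
    by (induction \<mu>) (auto simp: x_def power_add)
  have "real (card (subpartitions \<nu>)) * (q ^ n * z ^ a) = (\<Sum>\<mu>\<in>subpartitions \<nu>. q ^ n * z ^ a)" by simp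
  also have "\<dots> \<le> (\<Sum>\<mu>\<in>subpartitions \<nu>. prod_list (map x \<mu>))"
  proof (rule sum_mono)
    fix \<mu> assume "\<mu> \<in> subpartitions \<nu>"
    then have "sum_list \<mu> \<le> n" "length (filter ((\<le>) b) \<mu>) \<le> a"
      using \<nu> subpartitions_sum_list[of \<mu> \<nu>] subpartitions_filter[of \<mu> \<nu> b] a
      by (auto simp: subpartitions_def partition_of_def)
    then show "q ^ n * z ^ a \<le> prod_list (map x \<mu>)"
      unfolding x_list using q z by (intro mult_mono power_decreasing) auto
  qed
  also have "\<dots> \<le> (\<Prod>j=1..n. 1 / (1 - x j))"
  proof (rule sum_partition_weights_le[OF finite_subpartitions])
    fix \<mu> assume \<mu>: "\<mu> \<in> subpartitions \<nu>"
    then show part: "is_partition \<mu>" by (simp add: subpartitions_def subpartition_def)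
    have "j \<le> n" if "j \<in> set \<mu>" for j
      using member_le_sum_list[OF that] subpartitions_sum_list[of \<mu> \<nu>] \<mu> \<nu> by (simp add: subpartitions_def partition_of_def)
    then show "set \<mu> \<subseteq> {1..n}"
      using part by (fastforce simp: is_partition_def)
  next
    fix j assume "j \<in> {1..n}"
    then have "q ^ j < 1" using q by (simp add: power_less_one_iff)
    moreover have "q ^ j * z \<le> q ^ j" using q z by (intro mult_left_le) auto
    ultimately have "q ^ j * z < 1" by linarith
    with \<open>q ^ j < 1\<close> show "0 \<le> x j \<and> x j < 1" using q z by (auto simp: x_def)
  qed
  finally show ?thesis by (simp add: x_def)
qed

lemma card_subpartitions_pos: "is_partition \<nu> \<Longrightarrow> 0 < card (subpartitions \<nu>)"
  using finite_subpartitions by (auto simp: card_gt_0_iff subpartitions_def subpartition_def)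

text \<open>
  The preceding bound at \<open>q = exp (- 1 / scale n)\<close> and \<open>z = 1 - \<eta>\<close>. Here \<open>- n * ln q\<close> and the logarithm
  of Euler's product, a lower Riemann sum of \<open>ell\<close>, each contribute at most \<open>pi\<^sup>2 / 6 * scale n\<close>; what
  remains is the effect of the tilt by \<open>z\<close>.
\<close>

lemma ln_card_subpartitions_tilted:
  assumes n: "1 \<le> n" and \<nu>: "partition_of n \<nu>" and \<eta>: "0 \<le> \<eta>" "\<eta> < 1"
    and a: "length (filter ((\<le>) b) \<nu>) \<le> a" and b: "1 \<le> b"
  shows "ln (real (card (subpartitions \<nu>))) \<le> pi\<^sup>2 / 3 * scale n - real a * ln (1 - \<eta>)
            - (\<Sum>j=b..n. ln (1 + \<eta> / (exp (real j / scale n) - 1)))"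
proof -
  define T q z where "T = scale n" and "q = exp (- 1 / T)" and "z = 1 - \<eta>"
  have T: "0 < T" using scale_pos[OF n] by (simp add: T_def)
  have q: "0 < q" "q < 1" using T by (auto simp: q_def)
  have z: "0 < z" "z \<le> 1" using \<eta> by (auto simp: z_def)
  have qj: "q ^ j = exp (- (real j / T))" for j
    unfolding q_def by (simp flip: exp_of_nat_mult)
  define x where "x j = q ^ j * (if b \<le> j then z else 1)" for j :: nat
  have factor: "0 < 1 - x j \<and>
      - ln (1 - x j) = ell (real j / T) - (if b \<le> j then ln (1 + \<eta> / (exp (real j / T) - 1)) else 0)"
    if j: "j \<in> {1..n}" for j
  proof -
    define y where "y = exp (real j / T)"
    have y: "1 < y" using T j by (simp add: y_def)
    have qy: "q ^ j = 1 / y" by (simp add: qj y_def exp_minus field_simps)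
    have ell: "ell (real j / T) = - ln (1 - 1 / y)"
      by (simp add: ell_def y_def exp_minus field_simps)
    show ?thesis
    proof (cases "b \<le> j")
      case True
      have prod: "1 - x j = (1 - 1 / y) * (1 + \<eta> / (y - 1))"
        using y True by (simp add: x_def qy z_def field_simps)
      moreover have pos: "0 < 1 - 1 / y" "0 < 1 + \<eta> / (y - 1)"
        using y \<eta> by (auto simp: add_pos_nonneg)
      ultimately show ?thesis
        using True by (simp add: ln_mult ell y_def[symmetric])
    next
      case False
      then show ?thesis using y by (simp add: x_def qy ell)
    qed
  qed
  have card: "0 < real (card (subpartitions \<nu>))"
    using \<nu> by (simp add: partition_of_def card_subpartitions_pos)
  have "ln (real (card (subpartitions \<nu>))) - real n / T + real a * ln z
        = ln (real (card (subpartitions \<nu>)) * (q ^ n * z ^ a))"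
    using card q z by (simp add: ln_mult ln_realpow q_def)
  also have "\<dots> \<le> ln (\<Prod>j=1..n. 1 / (1 - x j))"
    unfolding x_def using card_subpartitions_weighted_le[OF \<nu> q z a] card q z by (intro ln_mono) auto
  also have "\<dots> = (\<Sum>j=1..n. ln (1 / (1 - x j)))"
  proof (rule ln_prod)
    fix j assume "j \<in> {1..n}"
    from factor[OF this] show "1 / (1 - x j) \<noteq> 0" by simp
  qed simp
  also have "\<dots> = (\<Sum>j=1..n. - ln (1 - x j))"
    by (intro sum.cong refl) (simp add: ln_div)
  also have "\<dots> = (\<Sum>j=1..n. ell (real j / T) - (if b \<le> j then ln (1 + \<eta> / (exp (real j / T) - 1)) else 0))"
    using factor by (intro sum.cong) auto
  also have "\<dots> = (\<Sum>j=1..n. ell (real j / T)) - (\<Sum>j=b..n. ln (1 + \<eta> / (exp (real j / T) - 1)))"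
  proof -
    have "{1..n} \<inter> {j. b \<le> j} = {b..n}" using b by auto
    then show ?thesis by (simp add: sum_subtractf sum.If_cases)
  qed
  also have "(\<Sum>j=1..n. ell (real j / T)) \<le> T * (pi\<^sup>2 / 6)"
  proof -
    have "1 / T * (\<Sum>j=1..n. ell (real j / T)) = 1 / T * (\<Sum>i<n. ell (0 + real (Suc i) * (1 / T)))"
      by (simp add: sum.shift_bounds_cl_Suc_ivl lessThan_atLeast0 sum.atLeast1_atMost_eq)
    also have "\<dots> \<le> area 0 (0 + real n * (1 / T))"
      using T by (intro riemann_sum_le_area) auto
    also have "\<dots> \<le> pi\<^sup>2 / 6" by (rule area_le) simp
    finally show ?thesis using T by (simp add: field_simps)
  qed
  also have "real n / T = T * (pi\<^sup>2 / 6)"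
    using T scale_square[of n] by (simp add: T_def field_simps power2_eq_square)
  finally show ?thesis by (simp add: T_def z_def algebra_simps)
qed

corollary ln_card_subpartitions_le:
  assumes "1 \<le> n" "partition_of n \<nu>"
  shows "ln (real (card (subpartitions \<nu>))) \<le> pi\<^sup>2 / 3 * scale n"
  using ln_card_subpartitions_tilted[OF assms, where \<eta> = 0 and b = 1 and a = "length \<nu>"] by simp

section \<open>Diagrams missing a point below the curve\<close>

lemma reciprocal_ge_ell_difference:
  assumes "0 < u" "u < v"
  shows "ell u - ell v \<le> (v - u) / (exp u - 1)"
proof -
  obtain \<xi> where "u < \<xi>" "\<xi> < v" "ell u - ell v = (v - u) / (exp \<xi> - 1)"
    using ell_difference[OF assms] by blast
  then show ?thesis using assms by (auto intro!: divide_left_mono)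
qed

text \<open>
  The effect of the tilt when the corner \<open>(u, v)\<close> of the rescaled diagram is missing. To first order in
  \<open>\<eta>\<close> the constraint costs \<open>u * \<eta>\<close>, whereas the tilted product gains \<open>\<eta>\<close> times the expected number of
  parts of length at least \<open>v\<close>, which is about \<open>ell v\<close>; the number \<open>e\<close> stands for a lower estimate of it.
\<close>

lemma ln_card_subpartitions_corner:
  assumes n: "1 \<le> n" and \<nu>: "partition_of n \<nu>"
    and u: "0 < u" and v: "0 < v"
    and few: "real (length (filter (\<lambda>p. v * scale n \<le> real p) \<nu>)) \<le> u * scale n"
    and \<eta>: "0 \<le> \<eta>" "\<eta> \<le> 1 / 2" "\<eta> \<le> exp v - 1"
    and e: "e \<le> ell (v + 1 / scale n) - ell ((real n + 1) / scale n)" "0 \<le> e"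
  shows "ln (real (card (subpartitions \<nu>)))
           \<le> (pi\<^sup>2 / 3 + u * (\<eta> + 2 * \<eta>\<^sup>2) - (\<eta> - \<eta>\<^sup>2 / (exp v - 1)) * e) * scale n"
proof -
  define T b a r where "T = scale n" and "b = nat \<lceil>v * T\<rceil>"
    and "a = length (filter ((\<le>) b) \<nu>)" and "r j = 1 / (exp (real j / T) - 1)" for j :: nat
  have T: "0 < T" using scale_pos[OF n] by (simp add: T_def)
  have "0 < v * T" using v T by simp
  then have b: "1 \<le> b" "v * T \<le> real b" "real b \<le> v * T + 1"
    unfolding b_def by linarith+
  have "((\<le>) b) = (\<lambda>p. v * T \<le> real p)"
    unfolding b_def by (auto simp: fun_eq_iff)
  then have a: "real a \<le> u * T"
    using few by (simp add: a_def T_def)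
  have ev: "0 < exp v - 1" using v by simp
  have r: "0 \<le> r j" "r j \<le> 1 / (exp v - 1)" if "b \<le> j" for j
  proof -
    have "v * T \<le> real j" using b that by linarith
    then have "v \<le> real j / T" using T by (simp add: field_simps)
    then have "exp v \<le> exp (real j / T)" by simp
    then show "0 \<le> r j" "r j \<le> 1 / (exp v - 1)"
      using ev by (auto simp: r_def intro!: divide_left_mono mult_pos_pos)
  qed
  have coeff: "0 \<le> \<eta> - \<eta>\<^sup>2 / (exp v - 1)"
  proof -
    have "\<eta> * \<eta> \<le> \<eta> * (exp v - 1)" using \<eta> by (intro mult_left_mono) auto
    then show ?thesis using ev by (simp add: field_simps power2_eq_square)
  qed
  have "(\<eta> - \<eta>\<^sup>2 / (exp v - 1)) * e * T \<le> (\<eta> - \<eta>\<^sup>2 / (exp v - 1)) * (\<Sum>j=b..n. r j)"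
  proof -
    have "e * T \<le> (\<Sum>j=b..n. r j)"
    proof (cases "b \<le> n")
      case True
      have "real b / T \<le> v + 1 / T" using b T by (simp add: field_simps)
      then have "ell (v + 1 / T) \<le> ell (real b / T)"
        using b T by (intro ell_antimono) auto
      then have "e \<le> ell (real b / T) - ell (real (n + 1) / T)"
        using e by (simp add: T_def add.commute)
      also have "\<dots> = (\<Sum>j=b..n. ell (real j / T) - ell (real (j + 1) / T))"
        using True sum_natinterval_diff[of "\<lambda>j. ell (real j / T)" b n] by simp
      also have "\<dots> \<le> (\<Sum>j=b..n. r j / T)"
      proof (rule sum_mono)
        fix j assume "j \<in> {b..n}"
        then have "0 < real j / T" "real j / T < real (j + 1) / T"
          using b T by (auto simp: divide_strict_right_mono)
        from reciprocal_ge_ell_difference[OF this]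
        show "ell (real j / T) - ell (real (j + 1) / T) \<le> r j / T"
          using T by (simp add: r_def field_simps)
      qed
      finally show ?thesis
        using T by (simp add: sum_divide_distrib[symmetric] field_simps)
    next
      case False
      then have "(real n + 1) / T \<le> v + 1 / T"
        using b T by (simp add: field_simps)
      then have "ell (v + 1 / T) \<le> ell ((real n + 1) / T)"
        using T by (intro ell_antimono) auto
      with e have "e = 0" by (simp add: T_def)
      then show ?thesis using False by simp
    qed
    from mult_left_mono[OF this coeff] show ?thesis by (simp add: mult.assoc)
  qed
  also have "\<dots> \<le> (\<Sum>j=b..n. ln (1 + \<eta> * r j))"
    unfolding sum_distrib_left
  proof (rule sum_mono)
    fix j assume "j \<in> {b..n}"
    then have rj: "0 \<le> r j" "r j \<le> 1 / (exp v - 1)" using r by auto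
    have "\<eta> * r j \<le> \<eta> * (1 / (exp v - 1))" using \<eta> rj by (intro mult_left_mono)
    also have "\<dots> \<le> 1" using \<eta> ev by simp
    finally have "\<eta> * r j - (\<eta> * r j)\<^sup>2 \<le> ln (1 + \<eta> * r j)"
      using rj \<eta> by (intro ln_one_plus_pos_lower_bound) auto
    moreover have "(\<eta> * r j)\<^sup>2 \<le> \<eta>\<^sup>2 / (exp v - 1) * r j"
    proof -
      have "\<eta>\<^sup>2 * r j * r j \<le> \<eta>\<^sup>2 * r j * (1 / (exp v - 1))"
        using rj by (intro mult_left_mono mult_nonneg_nonneg) auto
      then show ?thesis by (simp add: power2_eq_square mult_ac)
    qed
    ultimately show "(\<eta> - \<eta>\<^sup>2 / (exp v - 1)) * r j \<le> ln (1 + \<eta> * r j)"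
      by (simp add: algebra_simps)
  qed
  finally have gain: "(\<eta> - \<eta>\<^sup>2 / (exp v - 1)) * e * T \<le> (\<Sum>j=b..n. ln (1 + \<eta> * r j))" .
  have "- real a * ln (1 - \<eta>) \<le> real a * (\<eta> + 2 * \<eta>\<^sup>2)"
    using mult_left_mono[OF ln_one_minus_pos_lower_bound[OF \<eta>(1,2)], of "real a"]
    by (simp add: algebra_simps)
  also have "\<dots> \<le> u * T * (\<eta> + 2 * \<eta>\<^sup>2)"
    using a \<eta> by (intro mult_right_mono) auto
  finally have loss: "- real a * ln (1 - \<eta>) \<le> u * T * (\<eta> + 2 * \<eta>\<^sup>2)" .
  have "ln (real (card (subpartitions \<nu>))) \<le> pi\<^sup>2 / 3 * T - real a * ln (1 - \<eta>) - (\<Sum>j=b..n. ln (1 + \<eta> * r j))"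
    using ln_card_subpartitions_tilted[OF n \<nu> \<eta>(1) _ _ b(1), where a = a] \<eta>
    by (simp add: a_def T_def r_def)
  with gain loss show ?thesis by (simp add: algebra_simps T_def[symmetric])
qed

text \<open>
  If the missing corner lies strictly below the curve, then \<open>u < ell v\<close>, the first-order gain beats the
  first-order cost, and a small fixed \<open>\<eta>\<close> makes the saving exponential.
\<close>

lemma few_subpartitions_if_below_curve:
  assumes u: "0 < u" and v: "0 < v" and below: "v < ell u"
  obtains \<delta> where "0 < \<delta>"
    "\<forall>\<^sub>F n in sequentially. \<forall>\<nu>. partition_of n \<nu> \<longrightarrow>
       real (length (filter (\<lambda>p. v * scale n \<le> real p) \<nu>)) \<le> u * scale n \<longrightarrow>
       ln (real (card (subpartitions \<nu>))) \<le> (pi\<^sup>2 / 3 - \<delta>) * scale n"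
proof -
  \<comment> \<open>\<open>e\<close> lies strictly between the permitted number \<open>u\<close> of parts and the expected number \<open>ell v\<close>;
    \<open>\<eta>\<close> is so small that the second-order terms use up at most half of the gain \<open>\<eta> * (e - u)\<close>.\<close>
  define K e where "K = 1 / (exp v - 1)" and "e = (u + ell v) / 2"
  have K: "0 < K" using v by (simp add: K_def)
  have "u < ell v"
    using ell_strict_antimono[OF v below] ell_ell[OF u] by simp
  then have e: "u < e" "e < ell v" "0 < e" using u by (auto simp: e_def)
  define D \<eta> where "D = 2 * u + K * e" and "\<eta> = min (1 / 2) (min (exp v - 1) ((e - u) / (2 * D)))"
  have D: "0 < D" using u K e by (simp add: D_def add_pos_pos)
  have \<eta>: "0 < \<eta>" "\<eta> \<le> 1 / 2" "\<eta> \<le> exp v - 1" "\<eta> \<le> (e - u) / (2 * D)"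
    using v e D by (simp_all only: \<eta>_def min.cobounded1 min_less_iff_conj min.coboundedI2) auto
  have "\<eta> * D \<le> (e - u) / 2" using \<eta>(4) D by (simp add: field_simps)
  from mult_left_mono[OF this, of \<eta>]
  have net: "u * (\<eta> + 2 * \<eta>\<^sup>2) - (\<eta> - \<eta>\<^sup>2 / (exp v - 1)) * e \<le> - (\<eta> * (e - u) / 2)"
    using \<eta>(1) by (simp add: D_def K_def algebra_simps power2_eq_square diff_divide_distrib)
  have "((\<lambda>n. ell (v + 1 / scale n) - ell ((real n + 1) / scale n)) \<longlongrightarrow> ell v - 0) sequentially"
  proof (rule tendsto_diff)
    have "(\<lambda>n. v + 1 / scale n) \<longlonglongrightarrow> v + 0"
      by (intro tendsto_intros real_tendsto_divide_at_top[OF tendsto_const] scale_at_top)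
    then show "(\<lambda>n. ell (v + 1 / scale n)) \<longlonglongrightarrow> ell v"
      using DERIV_isCont[OF DERIV_ell[OF v]] by (intro isCont_tendsto_compose[of v ell]) auto
    show "(\<lambda>n. ell ((real n + 1) / scale n)) \<longlonglongrightarrow> 0"
      unfolding ell_def scale_def by real_asymp
  qed
  then have "\<forall>\<^sub>F n in sequentially. e < ell (v + 1 / scale n) - ell ((real n + 1) / scale n)"
    using e by (intro order_tendstoD(1)) auto
  then have "\<forall>\<^sub>F n in sequentially. \<forall>\<nu>. partition_of n \<nu> \<longrightarrow>
       real (length (filter (\<lambda>p. v * scale n \<le> real p) \<nu>)) \<le> u * scale n \<longrightarrow>
       ln (real (card (subpartitions \<nu>))) \<le> (pi\<^sup>2 / 3 - \<eta> * (e - u) / 2) * scale n"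
    using eventually_ge_at_top[of 1]
  proof (eventually_elim, intro allI impI)
    fix n \<nu>
    assume n: "e < ell (v + 1 / scale n) - ell ((real n + 1) / scale n)" "1 \<le> n"
      and \<nu>: "partition_of n \<nu>"
        "real (length (filter (\<lambda>p. v * scale n \<le> real p) \<nu>)) \<le> u * scale n"
    have "ln (real (card (subpartitions \<nu>)))
           \<le> (pi\<^sup>2 / 3 + u * (\<eta> + 2 * \<eta>\<^sup>2) - (\<eta> - \<eta>\<^sup>2 / (exp v - 1)) * e) * scale n"
      using \<eta> e n by (intro ln_card_subpartitions_corner \<nu> u v) auto
    also have "\<dots> \<le> (pi\<^sup>2 / 3 - \<eta> * (e - u) / 2) * scale n"
      using net scale_pos[OF n(2)] by (intro mult_right_mono) auto
    finally show "ln (real (card (subpartitions \<nu>))) \<le> (pi\<^sup>2 / 3 - \<eta> * (e - u) / 2) * scale n" .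
  qed
  moreover have "0 < \<eta> * (e - u) / 2" using \<eta> e by simp
  ultimately show ?thesis using that by blast
qed

section \<open>Convergence of diagrams in area and in boundary\<close>

text \<open>
  The diagram as a region below a step function: row \<open>i\<close>, counted from 0, occupies \<open>{i..<i + 1}\<close> on
  the horizontal axis.
\<close>

definition row_profile :: "nat list \<Rightarrow> real \<Rightarrow> real" where
  "row_profile \<nu> s = (\<Sum>i<length \<nu>. real (\<nu> ! i) * indicator {real i..<real i + 1} s)"

lemma row_profile_eq:
  assumes "0 \<le> s"
  shows "row_profile \<nu> s = (if nat \<lfloor>s\<rfloor> < length \<nu> then real (\<nu> ! nat \<lfloor>s\<rfloor>) else 0)"
proof -
  have "real i \<le> s \<and> s < real i + 1 \<longleftrightarrow> i = nat \<lfloor>s\<rfloor>" for i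
    using assms by linarith
  then have "row_profile \<nu> s = (\<Sum>i<length \<nu>. if i = nat \<lfloor>s\<rfloor> then real (\<nu> ! i) else 0)"
    unfolding row_profile_def by (intro sum.cong) (auto simp: indicator_def)
  then show ?thesis by simp
qed

lemma row_profile_nonneg: "0 \<le> row_profile \<nu> s"
  unfolding row_profile_def by (intro sum_nonneg) auto

lemma has_bochner_integral_row_profile:
  "has_bochner_integral lborel (row_profile \<nu>) (real (sum_list \<nu>))"
proof -
  have "has_bochner_integral lborel (\<lambda>s. indicator {real i..<real i + 1} s) (1::real)" for i
    by (simp add: has_bochner_integral_iff)
  then have "has_bochner_integral lborel (row_profile \<nu>) (\<Sum>i<length \<nu>. real (\<nu> ! i) * 1)"
    unfolding row_profile_def by (intro has_bochner_integral_sum has_bochner_integral_mult_right)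
  then show ?thesis
    by (simp add: sum_list_sum_nth atLeast0LessThan)
qed

lemma has_bochner_integral_rescaled_row_profile:
  assumes "0 < T"
  shows "has_bochner_integral lborel (\<lambda>s. row_profile \<nu> (T * s) / T) (real (sum_list \<nu>) / T\<^sup>2)"
proof -
  have "has_bochner_integral lborel (\<lambda>s. row_profile \<nu> (0 + T * s)) (real (sum_list \<nu>) /\<^sub>R \<bar>T\<bar>)"
    using has_bochner_integral_row_profile assms
    by (subst lborel_has_bochner_integral_real_affine_iff[symmetric]) auto
  from has_bochner_integral_divide[OF this, of T]
  show ?thesis using assms by (simp add: divide_inverse power2_eq_square mult_ac)
qed

lemma part_antimono:
  assumes "is_partition \<nu>" "i \<le> j" "j < length \<nu>"
  shows "\<nu> ! j \<le> \<nu> ! i"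
  using assms sorted_wrt_nth_less[of "(\<ge>)" \<nu> i j]
  by (cases "i = j") (auto simp: is_partition_def)

lemma row_profile_antimono:
  assumes "is_partition \<nu>" "0 \<le> s" "s \<le> s'"
  shows "row_profile \<nu> s' \<le> row_profile \<nu> s"
proof -
  have "nat \<lfloor>s\<rfloor> \<le> nat \<lfloor>s'\<rfloor>" using assms by (intro nat_mono floor_mono)
  with assms show ?thesis by (auto simp: row_profile_eq intro: part_antimono)
qed

lemma row_profile_ge_of_many_large_parts:
  assumes \<nu>: "is_partition \<nu>" and s: "0 \<le> s" and many: "s < real (length (filter (\<lambda>p. t \<le> real p) \<nu>))"
  shows "t \<le> row_profile \<nu> s"
proof (rule ccontr)
  assume less: "\<not> t \<le> row_profile \<nu> s"
  have "{i. i < length \<nu> \<and> t \<le> real (\<nu> ! i)} \<subseteq> {..<nat \<lfloor>s\<rfloor>}"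
  proof safe
    fix i assume i: "i < length \<nu>" "t \<le> real (\<nu> ! i)"
    show "i < nat \<lfloor>s\<rfloor>"
    proof (rule ccontr)
      assume "\<not> i < nat \<lfloor>s\<rfloor>"
      then have "\<nu> ! i \<le> \<nu> ! nat \<lfloor>s\<rfloor>" using part_antimono[OF \<nu> _ i(1)] by simp
      then show False using less i s \<open>\<not> i < nat \<lfloor>s\<rfloor>\<close> by (simp add: row_profile_eq)
    qed
  qed
  from card_mono[OF _ this] have "length (filter (\<lambda>p. t \<le> real p) \<nu>) \<le> nat \<lfloor>s\<rfloor>"
    by (simp add: length_filter_conv_card)
  then show False using many s by linarith
qed

lemma russian_box_iff:
  "(x, y) \<in> russian_box i j \<longleftrightarrow>
     real i - 1 \<le> (y + x) / sqrt 2 \<and> (y + x) / sqrt 2 \<le> real i \<and>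
     real j - 1 \<le> (y - x) / sqrt 2 \<and> (y - x) / sqrt 2 \<le> real j" (is "?L \<longleftrightarrow> ?R")
proof
  assume ?L
  then obtain s t where st: "x = (s - t) / sqrt 2" "y = (s + t) / sqrt 2"
    "real i - 1 \<le> s" "s \<le> real i" "real j - 1 \<le> t" "t \<le> real j"
    by (auto simp: russian_box_def)
  have "(y + x) / sqrt 2 = s" "(y - x) / sqrt 2 = t"
    unfolding st(1,2) by (auto simp: field_simps)
  then show ?R using st by simp
next
  assume ?R
  moreover have "x = ((y + x) / sqrt 2 - (y - x) / sqrt 2) / sqrt 2"
    "y = ((y + x) / sqrt 2 + (y - x) / sqrt 2) / sqrt 2"
    by (auto simp: field_simps)
  ultimately show ?L unfolding russian_box_def by blast
qed

lemma boundary_ge_abs: "\<bar>x\<bar> \<le> boundary \<nu> x"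
  by (rule boundary_greatest) (auto simp: russian_diagram_def)

text \<open>
  In the unrotated coordinates the boundary point over \<open>x\<close> is \<open>((y + x) / sqrt 2, (y - x) / sqrt 2)\<close>.
  The next two lemmas say that it lies on the completed graph of the row function; the values at the
  point itself, where the step function may jump, are left out.
\<close>

lemma row_profile_before_boundary:
  assumes \<nu>: "is_partition \<nu>" and s: "0 \<le> s" "s < (boundary \<nu> x + x) / sqrt 2"
  shows "(boundary \<nu> x - x) / sqrt 2 \<le> row_profile \<nu> s"
proof -
  define y where "y = boundary \<nu> x"
  have "(x, y) \<in> russian_diagram \<nu>" unfolding y_def by (rule boundary_greatest)
  then consider "y = \<bar>x\<bar>" | i j where "1 \<le> i" "i \<le> length \<nu>" "1 \<le> j" "j \<le> \<nu> ! (i - 1)" "(x, y) \<in> russian_box i j"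
    by (auto simp: russian_diagram_def)
  then have "(y - x) / sqrt 2 \<le> row_profile \<nu> s"
  proof cases
    case 1
    have "x \<ge> 0"
    proof (rule ccontr)
      assume "\<not> x \<ge> 0"
      with 1 have "y + x = 0" by simp
      with s show False by (simp add: y_def)
    qed
    with 1 row_profile_nonneg[of \<nu> s] show ?thesis by simp
  next
    case 2
    then have "s < real i" "(y - x) / sqrt 2 \<le> real j"
      using s by (auto simp: russian_box_iff y_def)
    then have i: "nat \<lfloor>s\<rfloor> \<le> i - 1" using 2(1) s by linarith
    have "\<nu> ! (i - 1) \<le> \<nu> ! nat \<lfloor>s\<rfloor>" using 2 i by (intro part_antimono[OF \<nu>]) auto
    moreover have "nat \<lfloor>s\<rfloor> < length \<nu>" using 2 i by linarith
    ultimately show ?thesis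
      using \<open>(y - x) / sqrt 2 \<le> real j\<close> 2 s by (simp add: row_profile_eq)
  qed
  then show ?thesis by (simp add: y_def)
qed

lemma row_profile_after_boundary:
  assumes \<nu>: "is_partition \<nu>" and s': "(boundary \<nu> x + x) / sqrt 2 < s'"
  shows "row_profile \<nu> s' \<le> (boundary \<nu> x - x) / sqrt 2"
proof (rule ccontr)
  define y s t where "y = boundary \<nu> x" and "s = (y + x) / sqrt 2" and "t = (y - x) / sqrt 2"
  assume "\<not> row_profile \<nu> s' \<le> (boundary \<nu> x - x) / sqrt 2"
  then have gt: "t < row_profile \<nu> s'" by (simp add: y_def t_def)
  have st: "0 \<le> s" "0 \<le> t" "s < s'"
    using boundary_ge_abs[of x \<nu>] s' by (auto simp: s_def t_def y_def)
  \<comment> \<open>If a later row were longer than \<open>t\<close>, the diagonal through the boundary point could be followed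
    upwards by \<open>\<delta>\<close> inside the diagram.\<close>
  define \<delta> where "\<delta> = min (s' - s) (row_profile \<nu> s' - t)"
  have \<delta>: "0 < \<delta>" "s + \<delta> \<le> s'" "t + \<delta> \<le> row_profile \<nu> s'"
    using gt st by (auto simp: \<delta>_def)
  define i j where "i = nat \<lfloor>s + \<delta>\<rfloor>" and "j = nat \<lceil>t + \<delta>\<rceil>"
  have "t + \<delta> \<le> row_profile \<nu> (s + \<delta>)"
    using \<delta> st row_profile_antimono[OF \<nu>, of "s + \<delta>" s'] by auto
  then have i: "i < length \<nu>" "t + \<delta> \<le> real (\<nu> ! i)"
    using \<delta> st by (auto simp: row_profile_eq i_def split: if_splits)
  have j: "1 \<le> j" "j \<le> \<nu> ! i" "real j - 1 \<le> t + \<delta>" "t + \<delta> \<le> real j"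
    using i(2) \<delta> st unfolding j_def by linarith+
  have i': "real i \<le> s + \<delta>" "s + \<delta> \<le> real i + 1"
    using \<delta> st unfolding i_def by linarith+
  have "(y + sqrt 2 * \<delta> + x) / sqrt 2 = s + \<delta>" "(y + sqrt 2 * \<delta> - x) / sqrt 2 = t + \<delta>"
    by (auto simp: s_def t_def field_simps)
  then have "(x, y + sqrt 2 * \<delta>) \<in> russian_box (Suc i) j"
    using i' j by (simp add: russian_box_iff)
  moreover have "Suc i \<in> {1..length \<nu>}" "j \<in> {1..\<nu> ! (Suc i - 1)}"
    using i j by auto
  ultimately have "(x, y + sqrt 2 * \<delta>) \<in> russian_diagram \<nu>"
    unfolding russian_diagram_def by blast
  then have "y + sqrt 2 * \<delta> \<le> y"
    unfolding y_def by (rule boundary_greatest)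
  with \<delta>(1) show False by (simp add: mult_le_0_iff)
qed

text \<open>
  The curve \<open>exp (- s) + exp (- t) = 1\<close>, rotated into the Russian position.
\<close>

definition limit_curve :: "real \<Rightarrow> real" where
  "limit_curve x = sqrt 2 * ln (2 * cosh (x / sqrt 2))"

lemma limit_curve_on_graph:
  fixes x :: real
  defines "s \<equiv> (limit_curve x + x) / sqrt 2" and "t \<equiv> (limit_curve x - x) / sqrt 2"
  shows "0 < s" "0 < t" "ell s = t"
proof -
  define w where "w = exp (x / sqrt 2)"
  have w: "0 < w" by (simp add: w_def)
  have c: "2 * cosh (x / sqrt 2) = w + 1 / w"
    by (simp add: cosh_def w_def exp_minus field_simps)
  have cpos: "0 < w + 1 / w" using w by (simp add: add_pos_pos)
  have s: "s = ln (w + 1 / w) + x / sqrt 2" and t: "t = ln (w + 1 / w) - x / sqrt 2"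
    by (simp_all add: s_def t_def limit_curve_def c add_divide_distrib diff_divide_distrib)
  have es: "exp s = (w + 1 / w) * w" and et: "exp t = (w + 1 / w) / w"
    using cpos by (simp_all add: s t exp_add exp_diff w_def[symmetric])
  have "1 < exp s" "1 < exp t" using w by (simp_all add: es et field_simps)
  then show st: "0 < s" "0 < t" by simp_all
  have "1 - exp (- s) = exp (- t)"
  proof -
    have "w + w * (w * w) \<noteq> 0" using w by (smt (verit) mult_pos_pos)
    then show ?thesis unfolding exp_minus es et using w cpos by (simp add: field_simps)
  qed
  then show "ell s = t" by (simp add: ell_def)
qed

text \<open>
  The area of the symmetric difference of the rescaled diagram and the region below \<open>ell\<close>.
\<close>

definition deviation :: "nat list \<Rightarrow> real \<Rightarrow> real" where
  "deviation \<nu> T = (\<integral>s. \<bar>row_profile \<nu> (T * s) / T - indicator {0<..} s * ell s\<bar> \<partial>lborel)"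

lemma deviation_integrable:
  assumes "0 < T"
  shows "integrable lborel (\<lambda>s. \<bar>row_profile \<nu> (T * s) / T - indicator {0<..} s * ell s\<bar>)"
  using has_bochner_integral_rescaled_row_profile[OF assms, of \<nu>] has_integral_ell(1)
  by (intro integrable_abs Bochner_Integration.integrable_diff)
     (auto simp: set_integrable_def has_bochner_integral_iff)

lemma deviation_ge_square:
  assumes T: "0 < T" and h: "0 \<le> h" and a: "0 \<le> a"
    and far: "\<And>s. a < s \<Longrightarrow> s < a + h \<Longrightarrow> h \<le> \<bar>row_profile \<nu> (T * s) / T - ell s\<bar>"
  shows "h\<^sup>2 \<le> deviation \<nu> T"
proof -
  have "integrable lborel (\<lambda>s. indicator {a<..<a + h} s * h)"
    by (intro integrable_mult_left integrable_real_indicator) (use h in auto)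
  then have "(\<integral>s. indicator {a<..<a + h} s * h \<partial>lborel) \<le> deviation \<nu> T"
    unfolding deviation_def using far a h
    by (intro integral_mono deviation_integrable[OF T]) (auto simp: indicator_def)
  then show ?thesis using h by (simp add: power2_eq_square)
qed

text \<open>
  If the two boundaries differ at \<open>x\<close> by the vector \<open>(h, h)\<close> in unrotated coordinates, then, both
  being monotone, the square with that diagonal lies in the symmetric difference. This bounds the
  vertical distance by the area, uniformly in \<open>x\<close>.
\<close>

lemma boundary_close_to_limit_curve:
  assumes \<nu>: "is_partition \<nu>" and T: "0 < T"
  shows "(boundary \<nu> (T * x) / T - limit_curve x)\<^sup>2 \<le> 2 * deviation \<nu> T"
proof -
  define s0 t0 where "s0 = (limit_curve x + x) / sqrt 2" and "t0 = (limit_curve x - x) / sqrt 2"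
  note curve = limit_curve_on_graph[of x, folded s0_def t0_def]
  define h where "h = (boundary \<nu> (T * x) / T - limit_curve x) / sqrt 2"
  have s: "(boundary \<nu> (T * x) + T * x) / sqrt 2 = T * (s0 + h)"
    and t: "(boundary \<nu> (T * x) - T * x) / sqrt 2 = T * (t0 + h)"
    using T by (simp_all add: s0_def t0_def h_def field_simps)
  have "0 \<le> T * (s0 + h)" unfolding s[symmetric]
    using boundary_ge_abs[of "T * x" \<nu>] by simp
  then have s_nonneg: "0 \<le> s0 + h" using T by (simp add: zero_le_mult_iff)
  have "\<bar>h\<bar>\<^sup>2 \<le> deviation \<nu> T"
  proof (cases "0 \<le> h")
    case True
    have "h \<le> \<bar>row_profile \<nu> (T * s) / T - ell s\<bar>" if "s0 < s" "s < s0 + h" for s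
    proof -
      have "T * (t0 + h) \<le> row_profile \<nu> (T * s)"
        using that T curve(1) unfolding t[symmetric] by (intro row_profile_before_boundary[OF \<nu>]) (auto simp: s)
      then have "t0 + h \<le> row_profile \<nu> (T * s) / T" using T by (simp add: field_simps)
      moreover have "ell s \<le> t0" using ell_antimono[of s0 s] that curve by simp
      ultimately show ?thesis by linarith
    qed
    then show ?thesis using deviation_ge_square[OF T True, of s0 \<nu>] curve True by simp
  next
    case False
    have "- h \<le> \<bar>row_profile \<nu> (T * s) / T - ell s\<bar>" if "s0 + h < s" "s < s0 + h + - h" for s
    proof -
      have "row_profile \<nu> (T * s) \<le> T * (t0 + h)"
        using that T unfolding t[symmetric] by (intro row_profile_after_boundary[OF \<nu>]) (auto simp: s)
      then have "row_profile \<nu> (T * s) / T \<le> t0 + h" using T by (simp add: field_simps)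
      moreover have "t0 \<le> ell s" using ell_antimono[of s s0] that curve s_nonneg by simp
      ultimately show ?thesis by linarith
    qed
    then show ?thesis using deviation_ge_square[OF T, of "- h" "s0 + h" \<nu>] False s_nonneg by simp
  qed
  then show ?thesis by (simp add: h_def power_divide)
qed

text \<open>
  Scheffe's argument: the two regions have the same area, so the area by which the diagram exceeds the
  limit region equals the area by which it falls short of it, and the latter tends to 0 by dominated
  convergence.
\<close>

lemma deviation_tendsto_0:
  assumes part: "\<And>n. 1 \<le> n \<Longrightarrow> partition_of n (\<nu> n)"
    and above: "\<And>u v. 0 < u \<Longrightarrow> 0 < v \<Longrightarrow> v < ell u \<Longrightarrow>
      \<forall>\<^sub>F n in sequentially. v * scale n \<le> row_profile (\<nu> n) (u * scale n)"
  shows "(\<lambda>n. deviation (\<nu> n) (scale n)) \<longlonglongrightarrow> 0"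
proof -
  define f R where "f s = indicator {0<..} s * ell s"
    and "R n s = row_profile (\<nu> n) (scale n * s) / scale n" for n and s :: real
  have f: "integrable lborel f" "integral\<^sup>L lborel f = pi\<^sup>2 / 6"
    using has_integral_ell unfolding set_integrable_def set_lebesgue_integral_def f_def by auto
  have f_nonneg: "0 \<le> f s" for s
    using ell_pos[of s] by (auto simp: f_def indicator_def)
  have R_nonneg: "0 \<le> R n s" for n s
    unfolding R_def scale_def by (intro divide_nonneg_nonneg row_profile_nonneg) auto
  have R: "has_bochner_integral lborel (R n) (pi\<^sup>2 / 6)" if "1 \<le> n" for n
  proof -
    have "real (sum_list (\<nu> n)) / (scale n)\<^sup>2 = pi\<^sup>2 / 6"
      using part[OF that] scale_square[of n] scale_pos[OF that]
      by (simp add: partition_of_def field_simps)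
    from has_bochner_integral_rescaled_row_profile[OF scale_pos[OF that], of "\<nu> n", unfolded this]
    show ?thesis by (simp add: R_def[abs_def])
  qed
  \<comment> \<open>The dominating function for the deficit is \<open>f\<close> itself, because diagrams are nonnegative.\<close>
  have deficit: "(\<lambda>n. \<integral>s. max 0 (f s - R n s) \<partial>lborel) \<longlonglongrightarrow> (\<integral>s. 0 \<partial>(lborel :: real measure))"
  proof (rule integral_dominated_convergence[where w = f])
    show "AE s in lborel. (\<lambda>n. max 0 (f s - R n s)) \<longlonglongrightarrow> 0"
    proof (rule AE_I2)
      fix s :: real
      show "(\<lambda>n. max 0 (f s - R n s)) \<longlonglongrightarrow> 0"
      proof (cases "0 < s")
        case True
        show ?thesis
        proof (rule order_tendstoI)
          fix a :: real assume "a < 0"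
          then show "\<forall>\<^sub>F n in sequentially. a < max 0 (f s - R n s)" by (simp add: less_max_iff_disj)
        next
          fix a :: real assume a: "0 < a"
          define v where "v = max (ell s / 2) (ell s - a / 2)"
          have v: "0 < v" "v < ell s" using ell_pos[OF True] a by (auto simp: v_def less_max_iff_disj)
          show "\<forall>\<^sub>F n in sequentially. max 0 (f s - R n s) < a"
            using above[OF True v] eventually_ge_at_top[of 1]
          proof eventually_elim
            case (elim n)
            then have "v \<le> R n s"
              using scale_pos[of n] by (simp add: R_def field_simps)
            moreover have "ell s - a / 2 \<le> v" by (simp add: v_def)
            ultimately show ?case using a True by (simp add: f_def)
          qed
        qed
      next
        case False
        then have "max 0 (f s - R n s) = 0" for n
          using R_nonneg[of n s] by (simp add: f_def)
        then show ?thesis by simp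
      qed
    qed
    show "AE s in lborel. norm (max 0 (f s - R n s)) \<le> f s" for n
      using f_nonneg R_nonneg by (intro AE_I2) (simp add: max_def)
    show "(\<lambda>s. max 0 (f s - R n s)) \<in> borel_measurable lborel" for n
      unfolding f_def R_def row_profile_def by measurable
  qed (use f in auto)
  have "deviation (\<nu> n) (scale n) = 2 * (\<integral>s. max 0 (f s - R n s) \<partial>lborel)" if "1 \<le> n" for n
  proof -
    have Rn: "integrable lborel (R n)" "integral\<^sup>L lborel (R n) = pi\<^sup>2 / 6"
      using R[OF that] by (auto simp: has_bochner_integral_iff)
    have int: "integrable lborel (\<lambda>s. max 0 (f s - R n s))"
      using f Rn by (intro integrable_max) auto
    have "deviation (\<nu> n) (scale n) = (\<integral>s. (R n s - f s) + 2 * max 0 (f s - R n s) \<partial>lborel)"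
      unfolding deviation_def by (intro Bochner_Integration.integral_cong) (auto simp: R_def f_def max_def abs_if)
    also have "\<dots> = 2 * (\<integral>s. max 0 (f s - R n s) \<partial>lborel)"
      using f Rn int by simp
    finally show ?thesis .
  qed
  then have "\<forall>\<^sub>F n in sequentially. 2 * (\<integral>s. max 0 (f s - R n s) \<partial>lborel) = deviation (\<nu> n) (scale n)"
    by (intro eventually_sequentiallyI[of 1]) simp
  moreover have "(\<lambda>n. 2 * (\<integral>s. max 0 (f s - R n s) \<partial>lborel)) \<longlonglongrightarrow> 0"
    using tendsto_mult_left[OF deficit, of 2] by simp
  ultimately show ?thesis by (rule Lim_transform_eventually[rotated])
qed

section \<open>Chains from staircases\<close>

definition block :: "nat \<Rightarrow> nat \<Rightarrow> nat \<Rightarrow> nat list set" where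
  "block a w m = {xs. sorted_wrt (\<ge>) xs \<and> length xs = m \<and> set xs \<subseteq> {a<..a + w}}"

lemma finite_block: "finite (block a w m)"
  by (rule finite_subset[OF _ finite_lists_length_eq[of "{a<..a + w}" m]]) (auto simp: block_def)

text \<open>
  Pascal's rule: a run either starts with the largest admitted value or does not use it.
\<close>

lemma card_block: "(w + m) choose m \<le> card (block a (Suc w) m)"
proof (induction m arbitrary: w)
  case 0
  have "block a (Suc w) 0 = {[]}" by (auto simp: block_def)
  then show ?case by simp
next
  case (Suc m)
  show ?case
  proof (induction w)
    case 0
    have "replicate (Suc m) (Suc a) \<in> block a (Suc 0) (Suc m)"
      by (auto simp: block_def sorted_wrt_iff_nth_less nth_Cons split: nat.splits)
    then show ?case
      using finite_block[of a "Suc 0" "Suc m"] by (auto simp: Suc_le_eq card_gt_0_iff)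
  next
    case (Suc w)
    let ?top = "Cons (a + Suc (Suc w)) ` block a (Suc (Suc w)) m"
    have "(Suc w + Suc m) choose Suc m = ((Suc w + m) choose m) + ((w + Suc m) choose Suc m)"
      by simp
    also have "\<dots> \<le> card (block a (Suc (Suc w)) m) + card (block a (Suc w) (Suc m))"
      using Suc.IH \<open>\<And>w. (w + m) choose m \<le> card (block a (Suc w) m)\<close>[of "Suc w"] by simp
    also have "\<dots> = card ?top + card (block a (Suc w) (Suc m))"
      by (simp add: card_image)
    also have "\<dots> = card (?top \<union> block a (Suc w) (Suc m))"
      by (intro card_Un_disjoint[symmetric] finite_imageI finite_block) (auto simp: block_def)
    also have "\<dots> \<le> card (block a (Suc (Suc w)) (Suc m))"
      by (intro card_mono finite_block) (fastforce simp: block_def)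
    finally show ?case .
  qed
qed

primrec staircase :: "(nat \<Rightarrow> nat) \<Rightarrow> nat \<Rightarrow> nat \<Rightarrow> nat list" where
  "staircase N w 0 = []"
| "staircase N w (Suc i) = replicate (N i) (i * w) @ staircase N w i"

text \<open>
  Partitions with \<open>N i\<close> parts in the window \<open>{i * w<..Suc i * w}\<close> for each \<open>i < m\<close>, larger parts first.
  Their diagrams contain the staircase and exceed it by at most \<open>w\<close> in each row; the choices in the
  different windows are independent.
\<close>

primrec corridor :: "(nat \<Rightarrow> nat) \<Rightarrow> nat \<Rightarrow> nat \<Rightarrow> nat list set" where
  "corridor N w 0 = {[]}"
| "corridor N w (Suc i) = (\<lambda>(ys, zs). ys @ zs) ` (block (i * w) w (N i) \<times> corridor N w i)"

lemma staircase_sorted: "sorted_wrt (\<ge>) (staircase N w m) \<and> set (staircase N w m) \<subseteq> {..m * w}"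
proof (induction m)
  case (Suc m)
  have "sorted_wrt (\<ge>) (replicate (N m) (m * w))"
    by (simp add: sorted_wrt_iff_nth_less)
  with Suc show ?case by (fastforce simp: sorted_wrt_append)
qed simp

lemma staircase_sum: "sum_list (map (\<lambda>p. p + c) (staircase N w m)) = (\<Sum>i<m. N i * (i * w + c))"
  by (induction m) (simp_all add: sum_list_replicate)

lemma corridor_finite: "finite (corridor N w m)"
  by (induction m) (auto intro!: finite_imageI finite_cartesian_product finite_block)

lemma corridor_card: "card (corridor N w m) = (\<Prod>i<m. card (block (i * w) w (N i)))"
proof (induction m)
  case (Suc m)
  have "inj_on (\<lambda>(ys, zs). ys @ zs) (block (m * w) w (N m) \<times> corridor N w m)"
    by (auto simp: inj_on_def block_def)
  then show ?case using Suc by (simp add: card_image card_cartesian_product mult.commute)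
qed simp

lemma corridor_bounds:
  assumes "x \<in> corridor N w m"
  shows "sorted_wrt (\<ge>) x \<and> set x \<subseteq> {..m * w} \<and>
    list_all2 (\<lambda>p y. p < y \<and> y \<le> p + w) (staircase N w m) x"
  using assms
proof (induction m arbitrary: x)
  case (Suc m)
  then obtain ys zs where x: "x = ys @ zs" "ys \<in> block (m * w) w (N m)" "zs \<in> corridor N w m"
    by auto
  note ih = Suc.IH[OF x(3)]
  have "list_all2 (\<lambda>p y. p < y \<and> y \<le> p + w) (replicate (N m) (m * w)) ys"
    using x(2) by (auto simp: block_def list_all2_conv_all_nth subset_iff)
  with ih have "list_all2 (\<lambda>p y. p < y \<and> y \<le> p + w) (staircase N w (Suc m)) x"
    unfolding x(1) by (simp add: list_all2_appendI)
  moreover have "sorted_wrt (\<ge>) x" "set x \<subseteq> {..Suc m * w}"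
    using ih x(2) unfolding x(1) by (fastforce simp: block_def sorted_wrt_append)+
  ultimately show ?case by blast
qed simp

text \<open>
  An arbitrary \<open>k\<close>-tuple of partitions in the corridor becomes a strict chain after widening: its
  \<open>j\<close>-th member, counted from 0, has all rows lengthened by \<open>(k - 1 - j) * w\<close>, so that the members
  occupy disjoint corridors lying side by side. Hence one construction serves both conventions.
  The \<open>e\<close> rows of length 1 only adjust the size of the ambient partition.
\<close>

lemma num_chains_ge_power:
  assumes le: "le = subpartition \<or> le = strict_subpartition"
    and S: "finite S" "\<And>x. x \<in> S \<Longrightarrow> sorted_wrt (\<ge>) x"
      "\<And>x. x \<in> S \<Longrightarrow> list_all2 (\<lambda>p y. p < y \<and> y \<le> p + w) \<beta> x"
    and \<beta>: "\<beta> \<noteq> []"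
  shows "card S ^ k \<le> num_chains le k (map (\<lambda>p. p + k * w) \<beta> @ replicate e 1)"
proof -
  let ?\<nu> = "map (\<lambda>p. p + k * w) \<beta> @ replicate e 1"
  define lift where "lift c j = map (\<lambda>y. y + (k - 1 - j) * w) (c ! j)" for c :: "nat list list" and j
  define G where "G c = map (lift c) [0..<k]" for c
  have len: "length (lift c j) = length \<beta>"
    and low: "\<And>r. r < length \<beta> \<Longrightarrow> \<beta> ! r + (k - 1 - j) * w < lift c j ! r"
    and high: "\<And>r. r < length \<beta> \<Longrightarrow> lift c j ! r \<le> \<beta> ! r + (k - j) * w"
    and part: "is_partition (lift c j)"
    if c: "set c \<subseteq> S" "length c = k" "j < k" for c j
  proof -
    have "c ! j \<in> S" using c by (auto simp: subset_iff)
    note S' = S(2,3)[OF this]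
    show len: "length (lift c j) = length \<beta>"
      using S'(2) by (simp add: lift_def list_all2_lengthD)
    show low: "\<beta> ! r + (k - 1 - j) * w < lift c j ! r" if "r < length \<beta>" for r
      using S'(2) that by (auto simp: lift_def list_all2_conv_all_nth)
    show "lift c j ! r \<le> \<beta> ! r + (k - j) * w" if "r < length \<beta>" for r
    proof -
      have "c ! j ! r \<le> \<beta> ! r + w" "length (c ! j) = length \<beta>"
        using S'(2) that by (auto simp: list_all2_conv_all_nth)
      moreover have "k - j = Suc (k - 1 - j)" using c(3) by simp
      ultimately show ?thesis using that by (simp add: lift_def)
    qed
    have "sorted_wrt (\<ge>) (lift c j)"
      using S'(1) by (simp add: lift_def sorted_wrt_map)
    moreover have "0 < p" if "p \<in> set (lift c j)" for p
      using that low len by (auto simp: in_set_conv_nth intro: le_less_trans[OF le0])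
    ultimately show "is_partition (lift c j)" by (auto simp: is_partition_def)
  qed
  have "G ` {c. set c \<subseteq> S \<and> length c = k} \<subseteq> chains le k ?\<nu>"
  proof
    fix C assume "C \<in> G ` {c. set c \<subseteq> S \<and> length c = k}"
    then obtain c where C: "C = G c" and c: "set c \<subseteq> S" "length c = k" by blast
    have "subpartition (lift c j) ?\<nu>" if "j < k" for j
    proof -
      have "lift c j ! r \<le> ?\<nu> ! r" if "r < length \<beta>" for r
      proof -
        have "(k - j) * w \<le> k * w" by (intro mult_right_mono) auto
        with high[OF c(1) c(2) \<open>j < k\<close> that] have "lift c j ! r \<le> \<beta> ! r + k * w"
          by linarith
        then show ?thesis using that by (simp add: nth_append)
      qed
      then show ?thesis
        using len[OF c(1) c(2) that] part[OF c(1) c(2) that]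
        by (simp add: subpartition_def)
    qed
    moreover have "le (lift c j) (lift c i)" if "i < j" "j < k" for i j
    proof -
      have "i < k" using that by simp
      note ci = c(1) c(2) this and cj = c(1) c(2) \<open>j < k\<close>
      have less: "lift c j ! r < lift c i ! r" if r: "r < length \<beta>" for r
      proof -
        have "(k - j) * w \<le> (k - 1 - i) * w" using that \<open>i < j\<close> by (intro mult_right_mono) auto
        with high[OF cj r] low[OF ci r] show ?thesis by linarith
      qed
      have "subpartition (lift c j) (lift c i)"
        using len[OF ci] len[OF cj] part[OF cj] less by (auto simp: subpartition_def intro: less_imp_le)
      moreover have "lift c j \<noteq> lift c i" using less[of 0] \<beta> by auto
      ultimately show ?thesis using le by (auto simp: strict_subpartition_def)
    qed
    ultimately show "C \<in> chains le k ?\<nu>"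
      by (auto simp: C chains_def G_def sorted_wrt_iff_nth_less)
  qed
  then have "card (G ` {c. set c \<subseteq> S \<and> length c = k}) \<le> num_chains le k ?\<nu>"
    unfolding num_chains_def by (intro card_mono finite_chains)
  moreover have "inj_on G {c. set c \<subseteq> S \<and> length c = k}"
  proof (rule inj_onI)
    fix c d assume "c \<in> {c. set c \<subseteq> S \<and> length c = k}" "d \<in> {c. set c \<subseteq> S \<and> length c = k}"
      and eq: "G c = G d"
    then have cd: "length c = k" "length d = k" by auto
    show "c = d"
    proof (rule nth_equalityI)
      fix j assume "j < length c"
      then have "lift c j = lift d j" using cd arg_cong[OF eq, of "\<lambda>l. l ! j"] by (simp add: G_def)
      moreover have "inj (\<lambda>y::nat. y + (k - 1 - j) * w)" by (simp add: inj_def)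
      ultimately show "c ! j = d ! j" unfolding lift_def by (simp add: inj_map_eq_map)
    qed (simp add: cd)
  qed
  ultimately show ?thesis
    using S(1) by (simp add: card_image card_lists_length_eq)
qed

lemma exists_partition_with_many_chains:
  assumes le: "le = subpartition \<or> le = strict_subpartition"
    and k: "1 \<le> k" and w: "1 \<le> w" and i0: "i0 < m" "0 < N i0"
    and size: "(\<Sum>i<m. N i * ((i + k) * w)) \<le> n"
  obtains \<nu> where "partition_of n \<nu>" "(\<Prod>i<m. (w - 1 + N i) choose N i) ^ k \<le> num_chains le k \<nu>"
proof -
  define \<beta> where "\<beta> = staircase N w m"
  define \<mu> where "\<mu> = map (\<lambda>p. p + k * w) \<beta>"
  define e where "e = n - sum_list \<mu>"
  have sum: "sum_list \<mu> = (\<Sum>i<m. N i * ((i + k) * w))"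
    unfolding \<mu>_def \<beta>_def staircase_sum by (simp add: algebra_simps)
  have "0 < N i0 * ((i0 + k) * w)" using i0 k w by simp
  also have "\<dots> \<le> sum_list \<mu>" unfolding sum
    using i0 by (intro member_le_sum[where f = "\<lambda>i. N i * ((i + k) * w)"]) auto
  finally have "\<beta> \<noteq> []" by (auto simp: \<mu>_def)
  have kw: "1 \<le> k * w" using k w by simp
  then have pos: "Suc 0 \<le> p + k * w" for p by linarith
  have "sorted_wrt (\<ge>) (replicate e (1::nat))" by (simp add: sorted_wrt_iff_nth_less)
  moreover have "sorted_wrt (\<ge>) \<mu>"
    using staircase_sorted[of N w m] by (simp add: \<mu>_def \<beta>_def sorted_wrt_map)
  ultimately have "sorted_wrt (\<ge>) (\<mu> @ replicate e 1)"
    using pos by (auto simp: sorted_wrt_append \<mu>_def)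
  moreover have "\<forall>p\<in>set (\<mu> @ replicate e 1). 0 < p" using kw by (auto simp: \<mu>_def)
  moreover have "sum_list (\<mu> @ replicate e 1) = n"
    using size unfolding sum[symmetric] by (simp add: e_def sum_list_replicate)
  ultimately have part: "partition_of n (\<mu> @ replicate e 1)"
    unfolding partition_of_def is_partition_def by (intro conjI)
  have block: "(w - 1 + N i) choose N i \<le> card (block (i * w) w (N i))" for i
    using card_block[of "w - 1" "N i" "i * w"] w by simp
  have "(\<Prod>i<m. (w - 1 + N i) choose N i) \<le> card (corridor N w m)"
    unfolding corridor_card by (intro prod_mono conjI block le0)
  then have "(\<Prod>i<m. (w - 1 + N i) choose N i) ^ k \<le> card (corridor N w m) ^ k"
    by (rule power_mono) simp
  also have "\<dots> \<le> num_chains le k (\<mu> @ replicate e 1)"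
    unfolding \<mu>_def
    by (rule num_chains_ge_power[OF le corridor_finite _ _ \<open>\<beta> \<noteq> []\<close>, where w = w])
       (simp_all only: corridor_bounds \<beta>_def)
  finally show ?thesis using that part by blast
qed

section \<open>Entropy of lattice paths along the curve\<close>

text \<open>
  The terms of the binomial expansion of \<open>(N + w) ^ (N + w)\<close> increase up to the index \<open>N\<close> and decrease
  from there on.
\<close>

lemma binomial_term_max:
  fixes N w j :: nat
  assumes j: "j \<le> N + w" and w: "1 \<le> w"
  shows "((N + w) choose j) * N ^ j * w ^ (N + w - j) \<le> ((N + w) choose N) * N ^ N * w ^ w"
proof -
  define K where "K = N + w"
  define t where "t j = (K choose j) * N ^ j * w ^ (K - j)" for j
  have ratio: "t (Suc j) * (Suc j * w) = t j * ((K - j) * N)" if "j < K" for j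
  proof -
    have "Suc j * (K choose Suc j) = (K - j) * (K choose j)"
      using binomial_absorption[of j K] binomial_absorb_comp[of K j] by simp
    moreover have "w ^ (K - j) = w * w ^ (K - Suc j)" using that by (metis Suc_diff_Suc power_Suc)
    ultimately have "(Suc j * (K choose Suc j)) * N ^ Suc j * (w * w ^ (K - Suc j))
        = ((K - j) * (K choose j)) * N ^ Suc j * w ^ (K - j)" by simp
    then show ?thesis unfolding t_def power_Suc by (simp only: mult_ac)
  qed
  have up: "t j \<le> t (Suc j)" if "j < N" for j
  proof -
    have "Suc j * w \<le> N * w" using that by (intro mult_right_mono) auto
    also have "\<dots> \<le> N * (K - j)" using that by (intro mult_left_mono) (auto simp: K_def)
    finally have "t j * (Suc j * w) \<le> t j * ((K - j) * N)"
      by (intro mult_left_mono) (simp_all add: mult.commute)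
    also have "\<dots> = t (Suc j) * (Suc j * w)" using ratio[of j] that by (simp add: K_def)
    finally show ?thesis using w by (simp del: mult_Suc)
  qed
  have down: "t (Suc j) \<le> t j" if "N \<le> j" "j < K" for j
  proof -
    have "(K - j) * N \<le> w * Suc j" using that by (intro mult_mono) (auto simp: K_def)
    then have "t j * ((K - j) * N) \<le> t j * (Suc j * w)"
      by (intro mult_left_mono) (simp_all add: mult.commute)
    then have "t (Suc j) * (Suc j * w) \<le> t j * (Suc j * w)"
      using ratio[OF that(2)] by simp
    then show ?thesis using w by (simp del: mult_Suc)
  qed
  have "t j \<le> t N"
  proof (cases "j \<le> N")
    case True
    then show ?thesis
    proof (induction rule: inc_induct)
      case (step i)
      then show ?case using up[of i] by simp
    qed simp
  next
    case False
    then have "N \<le> j" by simp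
    then show ?thesis using j
    proof (induction rule: dec_induct)
      case (step i)
      then show ?case using down[of i] by (simp add: K_def)
    qed simp
  qed
  then show ?thesis by (simp add: t_def K_def)
qed

text \<open>
  The largest of the \<open>N + w + 1\<close> terms of the expansion is at least the average; passing from
  \<open>(N + w) choose N\<close> to \<open>(w - 1 + N) choose N\<close> loses a factor \<open>(N + w) / w\<close>.
\<close>

lemma ln_binomial_ge:
  assumes N: "1 \<le> N" and w: "1 \<le> w"
  shows "real N * ln (real (N + w) / real N) + real w * ln (real (N + w) / real w) - 2 * ln (real (N + w) + 1)
       \<le> ln (real ((w - 1 + N) choose N))"
proof -
  define K B where "K = N + w" and "B = (K choose N)"
  have "K ^ K = (\<Sum>j\<le>K. (K choose j) * N ^ j * w ^ (K - j))"
    using binomial[of N w K] by (simp add: K_def)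
  also have "\<dots> \<le> (\<Sum>j\<le>K. B * N ^ N * w ^ w)"
    unfolding B_def K_def using w by (intro sum_mono binomial_term_max) simp_all
  finally have "K ^ K \<le> (K + 1) * (B * N ^ N * w ^ w)" by simp
  then have "real (K ^ K) \<le> real ((K + 1) * (B * N ^ N * w ^ w))" by (rule of_nat_mono)
  moreover have pos: "0 < K" "0 < B" "0 < (K - 1) choose N" using N w by (auto simp: K_def B_def)
  ultimately have "ln (real K ^ K) \<le> ln ((real K + 1) * (real B * real N ^ N * real w ^ w))"
    using N by (intro ln_mono) (auto simp: algebra_simps)
  then have B: "real K * ln (real K) \<le> ln (real K + 1) + ln (real B) + real N * ln (real N) + real w * ln (real w)"
    using pos N w by (simp add: ln_mult ln_realpow)
  have "K * ((K - 1) choose N) = w * B"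
    using binomial_absorb_comp[of K N] by (simp add: K_def B_def)
  then have "B \<le> K * ((K - 1) choose N)" using w by simp
  then have "real B \<le> real K * real ((K - 1) choose N)" by (metis of_nat_le_iff of_nat_mult)
  then have "ln (real B) \<le> ln (real K * real ((K - 1) choose N))"
    using pos by (intro ln_mono) auto
  also have "\<dots> = ln (real K) + ln (real ((K - 1) choose N))"
    using pos by (simp add: ln_mult)
  finally have "ln (real B) \<le> ln (real K) + ln (real ((K - 1) choose N))" .
  moreover have "ln (real K) \<le> ln (real K + 1)" using pos by (intro ln_mono) auto
  moreover have "K - 1 = w - 1 + N" using w by (simp add: K_def)
  moreover have "real N * ln (real K / real N) + real w * ln (real K / real w)
      = real K * ln (real K) - real N * ln (real N) - real w * ln (real w)"
    using N w pos by (simp add: ln_div K_def algebra_simps)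
  ultimately show ?thesis using B by (simp add: K_def)
qed

text \<open>
  The exponential growth rate of the number of lattice paths with \<open>x\<close> and \<open>y\<close> steps, in large units, in
  the two directions.
\<close>

definition path_entropy :: "real \<Rightarrow> real \<Rightarrow> real" where
  "path_entropy x y = x * ln ((x + y) / x) + y * ln ((x + y) / y)"

lemma path_entropy_scale:
  assumes "0 < c"
  shows "path_entropy (c * x) (c * y) = c * path_entropy x y"
  using assms by (simp add: path_entropy_def distrib_left[symmetric] mult.assoc)

lemma floor_quotient_tendsto:
  assumes "0 \<le> x" "filterlim T at_top F" 
  shows "((\<lambda>n. real (nat \<lfloor>x * T n\<rfloor>) / T n) \<longlongrightarrow> x) F"
proof (rule tendsto_sandwich)
  have T: "\<forall>\<^sub>F n in F. 0 < T n"
    using assms(2) by (simp add: filterlim_at_top_dense)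
  show "\<forall>\<^sub>F n in F. x - 1 / T n \<le> real (nat \<lfloor>x * T n\<rfloor>) / T n"
    using T
  proof eventually_elim
    case (elim n)
    have "x * T n - 1 \<le> real (nat \<lfloor>x * T n\<rfloor>)" by linarith
    from divide_right_mono[OF this, of "T n"] elim show ?case by (simp add: diff_divide_distrib)
  qed
  show "\<forall>\<^sub>F n in F. real (nat \<lfloor>x * T n\<rfloor>) / T n \<le> x"
    using T
  proof eventually_elim
    case (elim n)
    have "0 \<le> x * T n" using elim assms by simp
    then have "real (nat \<lfloor>x * T n\<rfloor>) \<le> x * T n" by linarith
    then show ?case using elim by (simp add: field_simps)
  qed
  have "((\<lambda>n. x - 1 / T n) \<longlongrightarrow> x - 0) F"
    by (intro tendsto_diff tendsto_const real_tendsto_divide_at_top[OF tendsto_const assms(2)])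
  then show "((\<lambda>n. x - 1 / T n) \<longlongrightarrow> x) F" by simp
qed simp

text \<open>
  The rounded numbers of steps, divided by \<open>T\<close>, tend to \<open>x\<close> and \<open>y\<close>; the error term is logarithmic in
  \<open>T\<close>.
\<close>

lemma eventually_ln_binomial_ge:
  assumes x: "0 < x" and y: "0 < y" and \<epsilon>: "0 < \<epsilon>" and T: "filterlim T at_top F"
  shows "\<forall>\<^sub>F n in F. (path_entropy x y - \<epsilon>) * T n
     \<le> ln (real ((nat \<lfloor>y * T n\<rfloor> - 1 + nat \<lfloor>x * T n\<rfloor>) choose nat \<lfloor>x * T n\<rfloor>))"
proof -
  define N w where "N n = nat \<lfloor>x * T n\<rfloor>" and "w n = nat \<lfloor>y * T n\<rfloor>" for n
  have T_pos: "\<forall>\<^sub>F n in F. 0 < T n"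
    using T by (simp add: filterlim_at_top_dense)
  have Nx: "((\<lambda>n. real (N n) / T n) \<longlongrightarrow> x) F" and wy: "((\<lambda>n. real (w n) / T n) \<longlongrightarrow> y) F"
    using x y T by (auto simp: N_def w_def intro!: floor_quotient_tendsto)
  define K where "K n = real (N n + w n) / T n" for n
  have K: "(K \<longlongrightarrow> x + y) F"
    using tendsto_add[OF Nx wy] by (simp add: K_def[abs_def] add_divide_distrib)
  have log: "((\<lambda>n. ln ((x + y) * T n + 1) / T n) \<longlongrightarrow> 0) F"
  proof -
    have "((\<lambda>t. ln ((x + y) * t + 1) / t) \<longlongrightarrow> 0) at_top" using x y by real_asymp
    then show ?thesis using T by (rule filterlim_compose)
  qed
  have "((\<lambda>n. real (N n) / T n * ln (K n / (real (N n) / T n)) + real (w n) / T n * ln (K n / (real (w n) / T n))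
      - 2 * (ln ((x + y) * T n + 1) / T n)) \<longlongrightarrow> x * ln ((x + y) / x) + y * ln ((x + y) / y) - 2 * 0) F"
    using x y by (intro tendsto_intros Nx wy K log) (auto simp: add_pos_pos)
  then have "\<forall>\<^sub>F n in F. path_entropy x y - \<epsilon> <
      real (N n) / T n * ln (K n / (real (N n) / T n)) + real (w n) / T n * ln (K n / (real (w n) / T n))
      - 2 * (ln ((x + y) * T n + 1) / T n)"
    using \<epsilon> by (intro order_tendstoD(1)) (auto simp: path_entropy_def)
  moreover have "\<forall>\<^sub>F n in F. 0 < real (N n) / T n" "\<forall>\<^sub>F n in F. 0 < real (w n) / T n"
    using order_tendstoD(1)[OF Nx x] order_tendstoD(1)[OF wy y] by auto
  ultimately show ?thesis
    using T_pos
  proof eventually_elim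
    case (elim n)
    then have Nw: "1 \<le> N n" "1 \<le> w n" by (auto simp: zero_less_divide_iff Suc_le_eq)
    have "real (N n) \<le> x * T n" "real (w n) \<le> y * T n"
      using x y elim by (simp_all add: N_def w_def)
    then have "ln (real (N n + w n) + 1) \<le> ln ((x + y) * T n + 1)"
      by (intro ln_mono) (auto simp: algebra_simps)
    moreover have "(path_entropy x y - \<epsilon>) * T n \<le> real (N n) * ln (real (N n + w n) / real (N n))
        + real (w n) * ln (real (N n + w n) / real (w n)) - 2 * ln ((x + y) * T n + 1)"
    proof -
      have "(path_entropy x y - \<epsilon>) * T n \<le> (real (N n) / T n * ln (K n / (real (N n) / T n))
         + real (w n) / T n * ln (K n / (real (w n) / T n)) - 2 * (ln ((x + y) * T n + 1) / T n)) * T n"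
        using elim by (intro mult_right_mono) auto
      also have "\<dots> = real (N n) * ln (real (N n + w n) / real (N n))
        + real (w n) * ln (real (N n + w n) / real (w n)) - 2 * ln ((x + y) * T n + 1)"
      proof -
        have "K n / (real (N n) / T n) = real (N n + w n) / real (N n)"
          "K n / (real (w n) / T n) = real (N n + w n) / real (w n)"
          using elim by (simp_all add: K_def)
        then show ?thesis using elim by (simp only:) (simp add: ring_distribs)
      qed
      finally show ?thesis .
    qed
    ultimately have "(path_entropy x y - \<epsilon>) * T n \<le> ln (real ((w n - 1 + N n) choose N n))"
      using ln_binomial_ge[OF Nw] by linarith
    then show ?case by (simp add: N_def w_def)
  qed
qed

text \<open>
  Along the chord of the curve over \<open>{b..b + h}\<close> the fraction of vertical steps is \<open>exp (- \<xi>)\<close> for some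
  \<open>\<xi>\<close> in between, by the mean value theorem. The entropy is therefore \<open>\<xi>\<close> times the height plus \<open>ell \<xi>\<close>
  times the width of the step: the areas of a horizontal and of a vertical strip below the curve.
  Summed over all steps, the strips of each kind fill the region, so the total is twice its area.
\<close>

lemma path_entropy_of_curve_step:
  assumes b: "0 < b" and h: "0 < h"
  shows "b * (ell b - ell (b + h)) + h * ell (b + h) \<le> path_entropy (ell b - ell (b + h)) h"
proof -
  obtain \<xi> where \<xi>: "b < \<xi>" "\<xi> < b + h" "ell b - ell (b + h) = (b + h - b) / (exp \<xi> - 1)"
    using ell_difference[of b "b + h"] b h by auto
  define x where "x = ell b - ell (b + h)"
  have e: "0 < exp \<xi> - 1" using b \<xi> by simp
  have x: "x = h / (exp \<xi> - 1)" using \<xi>(3) by (simp add: x_def)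
  have xpos: "0 < x" using h e by (simp add: x)
  have "(x + h) / x = exp \<xi>" using h e by (simp add: x field_simps)
  then have 1: "ln ((x + h) / x) = \<xi>" by simp
  have "(x + h) / h = 1 / (1 - exp (- \<xi>))" using h e by (simp add: x exp_minus field_simps)
  then have 2: "ln ((x + h) / h) = ell \<xi>" using b \<xi> by (simp add: ell_def ln_div)
  have "b * x \<le> x * \<xi>" using xpos \<xi> by (simp add: mult.commute)
  moreover have "h * ell (b + h) \<le> h * ell \<xi>" using h b \<xi> by (intro mult_left_mono ell_antimono) auto
  ultimately show ?thesis by (simp add: path_entropy_def 1 2 x_def[symmetric])
qed

text \<open>
  Summation by parts: the area of a staircase computed by horizontal strips is turned into vertical
  strips. It is used with \<open>c = k\<close> for the size of the ambient partition and with \<open>c = 1\<close> for the entropy.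
\<close>

lemma abel_sum_ell:
  "(\<Sum>i<m. (ell (h + real i * h) - ell (h + real (Suc i) * h)) * (real i + c))
     = c * ell h + (\<Sum>i<m. ell (h + real (Suc i) * h)) - (real m + c) * ell (h + real m * h)"
  by (induction m) (simp_all add: algebra_simps)

section \<open>Partitions with many chains\<close>

text \<open>
  Choice of the mesh width \<open>h\<close>, the number \<open>m\<close> of windows and the scaling factor \<open>\<sigma>\<close>. The widened
  staircase has area at most \<open>pi\<^sup>2 / 6 + k * (h * ell h)\<close>, and shrinking it by \<open>\<sigma>\<close> makes it fit; since
  \<open>h * ell h\<close> tends to 0 with \<open>h\<close>, the factor tends to 1. Meshes \<open>h = 1 / j\<close> with \<open>m + 1 = j\<^sup>2\<close> exhaust
  the curve at both ends.
\<close>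

lemma exists_fine_mesh:
  fixes k :: nat
  assumes "0 < \<epsilon>"
  obtains h \<sigma> m where "0 < h" "0 < \<sigma>" "1 \<le> m"
    "\<sigma>\<^sup>2 * (pi\<^sup>2 / 6 + real k * (h * ell h)) = pi\<^sup>2 / 6"
    "pi\<^sup>2 / 3 - \<epsilon> < \<sigma> * (area h (h + real (Suc m) * h) + area (2 * h) (2 * h + real m * h)
        - real (Suc m) * h * ell (real (Suc m) * h))"
proof -
  define h m where "h j = 1 / real (Suc j)" and "m j = (Suc j)\<^sup>2 - 1" for j
  define \<sigma> where "\<sigma> j = sqrt (pi\<^sup>2 / 6 / (pi\<^sup>2 / 6 + real k * (h j * ell (h j))))" for j
  have h: "0 < h j" for j by (simp add: h_def)
  have Sm: "Suc (m j) = (Suc j)\<^sup>2" for j by (simp add: m_def)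
  have mh: "real (Suc (m j)) * h j = real (Suc j)" for j
    unfolding Sm h_def of_nat_power by (simp add: power2_eq_square del: of_nat_Suc)
  have small: "(\<lambda>j. h j * ell (h j)) \<longlonglongrightarrow> 0"
    unfolding h_def ell_def by real_asymp
  have tail: "(\<lambda>j. real (Suc j) * ell (real (Suc j))) \<longlonglongrightarrow> 0"
    unfolding ell_def by real_asymp
  have h0: "h \<longlonglongrightarrow> 0" unfolding h_def by real_asymp
  have end1: "h j + real (Suc (m j)) * h j = h j + real (Suc j)" for j
    by (simp only: mh)
  have end2: "2 * h j + real (m j) * h j = h j + real (Suc j)" for j
    using mh[of j] by (simp add: algebra_simps)
  have top: "filterlim (\<lambda>j. h j + real (Suc j)) at_top sequentially"
    unfolding h_def by real_asymp
  have \<sigma>1: "\<sigma> \<longlonglongrightarrow> sqrt (pi\<^sup>2 / 6 / (pi\<^sup>2 / 6 + real k * 0))"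
    unfolding \<sigma>_def by (intro tendsto_intros small) auto
  have area1: "(\<lambda>j. area (h j) (h j + real (Suc j))) \<longlonglongrightarrow> pi\<^sup>2 / 6"
    using h by (intro area_tendsto h0 top) (auto intro: less_imp_le)
  have "(\<lambda>j. 2 * h j) \<longlonglongrightarrow> 0" using tendsto_mult_left[OF h0, of 2] by simp
  then have area2: "(\<lambda>j. area (2 * h j) (h j + real (Suc j))) \<longlonglongrightarrow> pi\<^sup>2 / 6"
    using h by (intro area_tendsto top) (auto intro: less_imp_le)
  have "(\<lambda>j. \<sigma> j * (area (h j) (h j + real (Suc j)) + area (2 * h j) (h j + real (Suc j))
      - real (Suc j) * ell (real (Suc j)))) \<longlonglongrightarrow>
      sqrt (pi\<^sup>2 / 6 / (pi\<^sup>2 / 6 + real k * 0)) * (pi\<^sup>2 / 6 + pi\<^sup>2 / 6 - 0)"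
    by (intro tendsto_intros \<sigma>1 area1 area2 tail)
  then have "\<forall>\<^sub>F j in sequentially. pi\<^sup>2 / 3 - \<epsilon> <
      \<sigma> j * (area (h j) (h j + real (Suc j)) + area (2 * h j) (h j + real (Suc j))
      - real (Suc j) * ell (real (Suc j)))"
    using assms by (intro order_tendstoD(1)) auto
  then have "\<forall>\<^sub>F j in sequentially. 1 \<le> j \<and> pi\<^sup>2 / 3 - \<epsilon> <
      \<sigma> j * (area (h j) (h j + real (Suc j)) + area (2 * h j) (h j + real (Suc j))
      - real (Suc j) * ell (real (Suc j)))"
    using eventually_ge_at_top[of 1] by eventually_elim auto
  then obtain j where j: "1 \<le> j" "pi\<^sup>2 / 3 - \<epsilon> <
      \<sigma> j * (area (h j) (h j + real (Suc j)) + area (2 * h j) (h j + real (Suc j))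
      - real (Suc j) * ell (real (Suc j)))"
    using eventually_happens'[OF sequentially_bot] by blast
  have den: "0 < pi\<^sup>2 / 6 + real k * (h j * ell (h j))"
    using h ell_pos[OF h] by (intro add_pos_nonneg mult_nonneg_nonneg) (auto intro: less_imp_le)
  show ?thesis
  proof (rule that[of "h j" "\<sigma> j" "m j"])
    show "0 < \<sigma> j" using den by (simp add: \<sigma>_def)
    have "(\<sigma> j)\<^sup>2 = pi\<^sup>2 / 6 / (pi\<^sup>2 / 6 + real k * (h j * ell (h j)))"
      unfolding \<sigma>_def using den by (intro real_sqrt_pow2) (auto intro!: divide_nonneg_nonneg)
    then show "(\<sigma> j)\<^sup>2 * (pi\<^sup>2 / 6 + real k * (h j * ell (h j))) = pi\<^sup>2 / 6"
      by (subst (asm) nonzero_eq_divide_eq) (use den in auto)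
    show "1 \<le> m j" using j(1) by (simp add: m_def power2_eq_square)
    show "pi\<^sup>2 / 3 - \<epsilon> < \<sigma> j * (area (h j) (h j + real (Suc (m j)) * h j)
        + area (2 * h j) (2 * h j + real (m j) * h j) - real (Suc (m j)) * h j * ell (real (Suc (m j)) * h j))"
      unfolding end1 end2 mh by (rule j(2))
  qed (rule h)
qed

text \<open>
  The staircase below the curve \<open>ell\<close>, scaled by \<open>\<sigma> * scale n\<close> and rounded down, with \<open>m\<close> and \<open>h\<close> fixed
  while \<open>n\<close> grows.
\<close>

lemma eventually_many_chains:
  assumes le: "le = subpartition \<or> le = strict_subpartition" and k: "1 \<le> k" and \<epsilon>: "0 < \<epsilon>"
  shows "\<forall>\<^sub>F n in sequentially. \<exists>\<nu>. partition_of n \<nu> \<and>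
    exp (real k * ((pi\<^sup>2 / 3 - \<epsilon>) * scale n)) \<le> real (num_chains le k \<nu>)"
proof -
  obtain h \<sigma> m where h: "0 < h" and \<sigma>: "0 < \<sigma>" and m: "1 \<le> m"
    and size: "\<sigma>\<^sup>2 * (pi\<^sup>2 / 6 + real k * (h * ell h)) = pi\<^sup>2 / 6"
    and big: "pi\<^sup>2 / 3 - \<epsilon> / 2 < \<sigma> * (area h (h + real (Suc m) * h) + area (2 * h) (2 * h + real m * h)
        - real (Suc m) * h * ell (real (Suc m) * h))"
    by (rule exists_fine_mesh[OF half_gt_zero[OF \<epsilon>], of k])
  define \<Delta> where "\<Delta> i = ell (h + real i * h) - ell (h + real (Suc i) * h)" for i
  have pos: "0 < h + real i * h" for i using h by (simp add: add_pos_nonneg)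
  have \<Delta>: "0 < \<Delta> i" for i
    unfolding \<Delta>_def using ell_strict_antimono[OF pos, of i "h + real (Suc i) * h"] h
    by (simp add: algebra_simps)
  define N w where "N n i = nat \<lfloor>\<sigma> * \<Delta> i * scale n\<rfloor>" and "w n = nat \<lfloor>\<sigma> * h * scale n\<rfloor>" for n i
  have below: "(\<Sum>i<m. N n i * ((i + k) * w n)) \<le> n" if n: "1 \<le> n" for n
  proof -
    have T: "0 < scale n" by (rule scale_pos[OF n])
    have sum_le: "h * (\<Sum>i<m. \<Delta> i * (real i + real k)) \<le> real k * (h * ell h) + pi\<^sup>2 / 6"
    proof -
      have "h * (\<Sum>i<m. \<Delta> i * (real i + real k)) = real k * (h * ell h)
          + h * (\<Sum>i<m. ell (h + real (Suc i) * h)) - h * ((real m + real k) * ell (h + real m * h))"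
        unfolding \<Delta>_def abel_sum_ell by (simp add: algebra_simps)
      also have "h * (\<Sum>i<m. ell (h + real (Suc i) * h)) \<le> pi\<^sup>2 / 6"
        using riemann_sum_le_area[of h h m] area_le[of h "h + real m * h"] h by linarith
      finally have "h * (\<Sum>i<m. \<Delta> i * (real i + real k))
          \<le> real k * (h * ell h) + pi\<^sup>2 / 6 - h * ((real m + real k) * ell (h + real m * h))"
        by simp
      moreover have "0 \<le> h * ((real m + real k) * ell (h + real m * h))"
        using h ell_pos[OF pos[of m]] by (intro mult_nonneg_nonneg) auto
      ultimately show ?thesis by linarith
    qed
    have "real (\<Sum>i<m. N n i * ((i + k) * w n)) = (\<Sum>i<m. real (N n i) * ((real i + real k) * real (w n)))"
      by simp
    also have "\<dots> \<le> (\<Sum>i<m. (\<sigma> * \<Delta> i * scale n) * ((real i + real k) * (\<sigma> * h * scale n)))"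
      using \<Delta> h \<sigma> T by (intro sum_mono mult_mono)
        (simp_all add: N_def w_def less_imp_le)
    also have "\<dots> = \<sigma>\<^sup>2 * (scale n)\<^sup>2 * (h * (\<Sum>i<m. \<Delta> i * (real i + real k)))"
      by (simp add: sum_distrib_left power2_eq_square mult_ac)
    also have "\<dots> \<le> \<sigma>\<^sup>2 * (scale n)\<^sup>2 * (real k * (h * ell h) + pi\<^sup>2 / 6)"
      by (intro mult_left_mono sum_le) auto
    also have "\<dots> = (scale n)\<^sup>2 * (\<sigma>\<^sup>2 * (pi\<^sup>2 / 6 + real k * (h * ell h)))"
      by (simp add: algebra_simps)
    also have "\<dots> = real n" unfolding size by (rule scale_square)
    finally show ?thesis by (simp only: of_nat_le_iff)
  qed
  have entropy: "pi\<^sup>2 / 3 - \<epsilon> / 2 < (\<Sum>i<m. path_entropy (\<sigma> * \<Delta> i) (\<sigma> * h))"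
  proof -
    have first: "area h (h + real (Suc m) * h) - real (Suc m) * h * ell (real (Suc m) * h)
        \<le> (\<Sum>i<m. (h + real i * h) * \<Delta> i)"
    proof -
      have "area h (h + real (Suc m) * h) \<le> h * (\<Sum>i<Suc m. ell (h + real i * h))"
        by (rule riemann_sum_ge_area[OF h h])
      also have "\<dots> = h * (ell h + (\<Sum>i<m. ell (h + real (Suc i) * h)))"
        by (simp only: sum.lessThan_Suc_shift) simp
      also have "\<dots> = h * (\<Sum>i<m. \<Delta> i * (real i + 1)) + real (Suc m) * h * ell (real (Suc m) * h)"
        unfolding \<Delta>_def abel_sum_ell by (simp add: algebra_simps)
      finally show ?thesis by (simp add: sum_distrib_left algebra_simps)
    qed
    have second: "area (2 * h) (2 * h + real m * h) \<le> (\<Sum>i<m. h * ell (h + real (Suc i) * h))"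
      using riemann_sum_ge_area[of "2 * h" h m] h by (simp add: sum_distrib_left algebra_simps)
    have "(\<Sum>i<m. (h + real i * h) * \<Delta> i) + (\<Sum>i<m. h * ell (h + real (Suc i) * h))
        \<le> (\<Sum>i<m. path_entropy (\<Delta> i) h)"
      unfolding sum.distrib[symmetric]
    proof (rule sum_mono)
      fix i
      show "(h + real i * h) * \<Delta> i + h * ell (h + real (Suc i) * h) \<le> path_entropy (\<Delta> i) h"
        using path_entropy_of_curve_step[OF pos[of i] h] by (simp add: \<Delta>_def algebra_simps)
    qed
    with first second have "area h (h + real (Suc m) * h) + area (2 * h) (2 * h + real m * h)
        - real (Suc m) * h * ell (real (Suc m) * h) \<le> (\<Sum>i<m. path_entropy (\<Delta> i) h)" by linarith
    from mult_left_mono[OF this, of \<sigma>] big \<sigma>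
    have "pi\<^sup>2 / 3 - \<epsilon> / 2 < \<sigma> * (\<Sum>i<m. path_entropy (\<Delta> i) h)" by linarith
    then show ?thesis by (simp add: path_entropy_scale[OF \<sigma>] sum_distrib_left)
  qed
  define \<eta> where "\<eta> = \<epsilon> / (2 * real m)"
  have \<eta>: "0 < \<eta>" using \<epsilon> m by (simp add: \<eta>_def)
  have "\<forall>\<^sub>F n in sequentially. \<forall>i\<in>{..<m}. (path_entropy (\<sigma> * \<Delta> i) (\<sigma> * h) - \<eta>) * scale n
      \<le> ln (real ((w n - 1 + N n i) choose N n i))"
    unfolding N_def w_def using \<sigma> \<Delta> h \<eta>
    by (intro eventually_ball_finite ballI eventually_ln_binomial_ge scale_at_top) auto
  moreover have "\<forall>\<^sub>F n in sequentially. 1 / (\<sigma> * h) \<le> scale n" "\<forall>\<^sub>F n in sequentially. 1 / (\<sigma> * \<Delta> 0) \<le> scale n"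
    using scale_at_top by (auto simp: filterlim_at_top)
  ultimately show ?thesis
    using eventually_ge_at_top[of 1]
  proof eventually_elim
    case (elim n)
    note T = scale_pos[OF \<open>1 \<le> n\<close>]
    have "1 \<le> \<sigma> * h * scale n" "1 \<le> \<sigma> * \<Delta> 0 * scale n"
      using elim(2,3) \<sigma> h \<Delta>[of 0] by (simp_all add: field_simps)
    then have wN: "1 \<le> w n" "0 < N n 0" unfolding w_def N_def by linarith+
    have "0 < m" using m by simp
    obtain \<nu> where \<nu>: "partition_of n \<nu>" "(\<Prod>i<m. (w n - 1 + N n i) choose N n i) ^ k \<le> num_chains le k \<nu>"
      by (rule exists_partition_with_many_chains[OF le k wN(1) \<open>0 < m\<close> wN(2) below[OF \<open>1 \<le> n\<close>]])
    have choose_pos: "0 < (w n - 1 + N n i) choose N n i" for i by simp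
    have "(pi\<^sup>2 / 3 - \<epsilon>) * scale n \<le> (\<Sum>i<m. path_entropy (\<sigma> * \<Delta> i) (\<sigma> * h) - \<eta>) * scale n"
      using entropy T m by (intro mult_right_mono) (auto simp: sum_subtractf \<eta>_def)
    also have "\<dots> = (\<Sum>i<m. (path_entropy (\<sigma> * \<Delta> i) (\<sigma> * h) - \<eta>) * scale n)"
      by (rule sum_distrib_right)
    also have "\<dots> \<le> (\<Sum>i<m. ln (real ((w n - 1 + N n i) choose N n i)))"
      using elim(1) by (intro sum_mono) auto
    also have "\<dots> = ln (real (\<Prod>i<m. (w n - 1 + N n i) choose N n i))"
      using choose_pos by (subst of_nat_prod, subst ln_prod) auto
    finally have "exp ((pi\<^sup>2 / 3 - \<epsilon>) * scale n) \<le> real (\<Prod>i<m. (w n - 1 + N n i) choose N n i)"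
      using choose_pos by (subst (asm) ln_ge_iff) (auto intro: prod_pos)
    then have "exp ((pi\<^sup>2 / 3 - \<epsilon>) * scale n) ^ k \<le> real (\<Prod>i<m. (w n - 1 + N n i) choose N n i) ^ k"
      by (intro power_mono) auto
    also have "\<dots> \<le> real (num_chains le k \<nu>)"
      using of_nat_mono[OF \<nu>(2), where ?'a = real] by (simp only: of_nat_power)
    finally have "exp (real k * ((pi\<^sup>2 / 3 - \<epsilon>) * scale n)) \<le> real (num_chains le k \<nu>)"
      by (simp only: exp_of_nat_mult)
    with \<nu>(1) show ?case by blast
  qed
qed

lemma num_chains_le_power: "num_chains le k \<nu> \<le> card (subpartitions \<nu>) ^ k"
proof -
  have "chains le k \<nu> \<subseteq> {c. set c \<subseteq> subpartitions \<nu> \<and> length c = k}"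
    by (auto simp: chains_def subpartitions_def)
  then have "num_chains le k \<nu> \<le> card {c. set c \<subseteq> subpartitions \<nu> \<and> length c = k}"
    unfolding num_chains_def by (intro card_mono finite_lists_length_eq finite_subpartitions)
  then show ?thesis by (simp add: card_lists_length_eq finite_subpartitions)
qed

section \<open>Growth and limit shape of the maximizers\<close>

theorem theorem1p2:
  fixes k :: nat
    and le :: "nat list \<Rightarrow> nat list \<Rightarrow> bool"
    and lam :: "nat \<Rightarrow> nat list"
  assumes "1 \<le> k"
    and "le = subpartition \<or> le = strict_subpartition"
    and "\<And>n. 1 \<le> n \<Longrightarrow> is_arg_max (num_chains le k) (partition_of n) (lam n)"
  shows "(\<exists>r :: nat \<Rightarrow> real.
            (\<lambda>n. r n / sqrt (real n)) \<longlonglongrightarrow> 0 \<and>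
            (\<forall>\<^sub>F n in sequentially.
               real (num_chains le k (lam n)) = exp (real k * pi * sqrt (2 * real n / 3) - r n))) \<and>
         uniform_limit UNIV (\<lambda>n. rescaled_boundary (lam n))
           (\<lambda>x. 2 * sqrt 3 / pi * ln (2 * cosh (pi / (2 * sqrt 3) * x))) sequentially"
proof
  note k = assms(1) and le = assms(2)
  have part: "partition_of n (lam n)" if "1 \<le> n" for n
    using assms(3)[OF that] by (simp add: is_arg_max_def)
  have best: "num_chains le k \<nu> \<le> num_chains le k (lam n)" if "1 \<le> n" "partition_of n \<nu>" for n \<nu>
    using assms(3)[OF that(1)] that(2) by (auto simp: is_arg_max_linorder)
  have lower: "\<forall>\<^sub>F n in sequentially.
      exp (real k * ((pi\<^sup>2 / 3 - \<epsilon>) * scale n)) \<le> real (num_chains le k (lam n))" if "0 < \<epsilon>" for \<epsilon>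
    using eventually_many_chains[OF le k that] eventually_ge_at_top[of 1]
  proof eventually_elim
    case (elim n)
    then obtain \<nu> where \<nu>: "partition_of n \<nu>"
      "exp (real k * ((pi\<^sup>2 / 3 - \<epsilon>) * scale n)) \<le> real (num_chains le k \<nu>)" by blast
    have "real (num_chains le k \<nu>) \<le> real (num_chains le k (lam n))"
      using best[OF elim(2) \<nu>(1)] by simp
    with \<nu>(2) show ?case by linarith
  qed
  have card_pos: "0 < card (subpartitions (lam n))" if "1 \<le> n" for n
    using part[OF that] by (simp add: partition_of_def card_subpartitions_pos)
  have chains_le: "ln (real (num_chains le k (lam n))) \<le> real k * ln (real (card (subpartitions (lam n))))"
    if "1 \<le> n" "0 < num_chains le k (lam n)" for n
  proof -
    have "real (num_chains le k (lam n)) \<le> real (card (subpartitions (lam n)) ^ k)"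
      by (rule of_nat_mono[OF num_chains_le_power])
    then have "ln (real (num_chains le k (lam n))) \<le> ln (real (card (subpartitions (lam n)) ^ k))"
      using that by (intro ln_mono) auto
    then show ?thesis using card_pos[OF that(1)] by (simp add: ln_realpow)
  qed
  have log_lower: "\<forall>\<^sub>F n in sequentially. 0 < num_chains le k (lam n) \<and>
      real k * ((pi\<^sup>2 / 3 - \<epsilon>) * scale n) \<le> ln (real (num_chains le k (lam n)))" if "0 < \<epsilon>" for \<epsilon>
    using lower[OF that]
  proof eventually_elim
    case (elim n)
    have "0 < real (num_chains le k (lam n))" using elim by (rule less_le_trans[OF exp_gt_zero])
    with elim show ?case by (simp add: ln_ge_iff)
  qed
  show "\<exists>r :: nat \<Rightarrow> real. (\<lambda>n. r n / sqrt (real n)) \<longlonglongrightarrow> 0 \<and>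
      (\<forall>\<^sub>F n in sequentially.
         real (num_chains le k (lam n)) = exp (real k * pi * sqrt (2 * real n / 3) - r n))"
  proof (intro exI conjI)
    define r where "r n = real k * pi * sqrt (2 * real n / 3) - ln (real (num_chains le k (lam n)))" for n
    have main: "real k * pi * sqrt (2 * real n / 3) = real k * (pi\<^sup>2 / 3 * scale n)" for n
    proof -
      have "sqrt (2 * real n / 3) = sqrt (6 * real n / 3\<^sup>2)" by simp
      also have "\<dots> = sqrt (6 * real n) / 3" by (subst real_sqrt_divide) simp
      finally show ?thesis by (simp add: scale_def power2_eq_square)
    qed
    have scale_sqrt: "scale n = sqrt 6 / pi * sqrt (real n)" for n
      by (simp add: scale_def real_sqrt_mult)
    show "(\<lambda>n. r n / sqrt (real n)) \<longlonglongrightarrow> 0"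
    proof (rule order_tendstoI)
      fix a :: real assume "a < 0"
      show "\<forall>\<^sub>F n in sequentially. a < r n / sqrt (real n)"
        using log_lower[of 1, OF zero_less_one] eventually_ge_at_top[of 1]
      proof eventually_elim
        case (elim n)
        have "ln (real (num_chains le k (lam n))) \<le> real k * ln (real (card (subpartitions (lam n))))"
          using elim by (intro chains_le) auto
        also have "\<dots> \<le> real k * (pi\<^sup>2 / 3 * scale n)"
          by (intro mult_left_mono ln_card_subpartitions_le elim part) auto
        finally have "0 \<le> r n" by (simp add: r_def main)
        then have "0 \<le> r n / sqrt (real n)" by simp
        with \<open>a < 0\<close> show ?case by linarith
      qed
    next
      fix a :: real assume a: "0 < a"
      define \<epsilon> where "\<epsilon> = a * pi / (2 * real k * sqrt 6)"
      have \<epsilon>: "0 < \<epsilon>" using a k by (simp add: \<epsilon>_def)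
      show "\<forall>\<^sub>F n in sequentially. r n / sqrt (real n) < a"
        using log_lower[OF \<epsilon>] eventually_ge_at_top[of 1]
      proof eventually_elim
        case (elim n)
        have "r n \<le> real k * (\<epsilon> * scale n)"
          unfolding r_def main using elim(1) by (simp add: algebra_simps)
        also have "\<dots> = a / 2 * sqrt (real n)"
          using k by (simp add: scale_sqrt \<epsilon>_def)
        finally have "r n / sqrt (real n) \<le> a / 2"
          using elim(2) by (simp add: field_simps)
        with a show ?case by linarith
      qed
    qed
    show "\<forall>\<^sub>F n in sequentially.
         real (num_chains le k (lam n)) = exp (real k * pi * sqrt (2 * real n / 3) - r n)"
      using log_lower[of 1, OF zero_less_one] by eventually_elim (simp add: r_def)
  qed
  have above: "\<forall>\<^sub>F n in sequentially. v * scale n \<le> row_profile (lam n) (u * scale n)"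
    if uv: "0 < u" "0 < v" "v < ell u" for u v
  proof -
    obtain \<delta> where \<delta>: "0 < \<delta>" and few: "\<forall>\<^sub>F n in sequentially. \<forall>\<nu>. partition_of n \<nu> \<longrightarrow>
       real (length (filter (\<lambda>p. v * scale n \<le> real p) \<nu>)) \<le> u * scale n \<longrightarrow>
       ln (real (card (subpartitions \<nu>))) \<le> (pi\<^sup>2 / 3 - \<delta>) * scale n"
      by (rule few_subpartitions_if_below_curve[OF uv])
    show ?thesis
      using few log_lower[OF half_gt_zero[OF \<delta>]] eventually_ge_at_top[of 1]
    proof eventually_elim
      case (elim n)
      have "real k * ((pi\<^sup>2 / 3 - \<delta> / 2) * scale n) \<le> real k * ln (real (card (subpartitions (lam n))))"
        using elim chains_le[of n] by linarith
      then have "(pi\<^sup>2 / 3 - \<delta> / 2) * scale n \<le> ln (real (card (subpartitions (lam n))))"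
        using k by simp
      moreover have "(pi\<^sup>2 / 3 - \<delta>) * scale n < (pi\<^sup>2 / 3 - \<delta> / 2) * scale n"
        using \<delta> scale_pos[OF elim(3)] by (intro mult_strict_right_mono) auto
      ultimately have "u * scale n < real (length (filter (\<lambda>p. v * scale n \<le> real p) (lam n)))"
        using elim(1) part[OF elim(3)] by (meson not_le order.strict_trans2 order.trans)
      moreover have "0 \<le> u * scale n" using uv scale_pos[OF elim(3)] by simp
      moreover have "is_partition (lam n)" using part[OF elim(3)] by (simp add: partition_of_def)
      ultimately show ?case by (intro row_profile_ge_of_many_large_parts)
    qed
  qed
  \<comment> \<open>\<open>c\<close> converts between the units \<open>sqrt n\<close> and \<open>scale n\<close>.\<close>
  define c where "c = pi / sqrt 6"
  have c: "0 < c" by (simp add: c_def)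
  have limit: "2 * sqrt 3 / pi * ln (2 * cosh (pi / (2 * sqrt 3) * x)) = limit_curve (c * x) / c" for x
  proof -
    have six: "sqrt 6 = sqrt 2 * sqrt 3" by (simp flip: real_sqrt_mult)
    have arg: "pi / (2 * sqrt 3) * x = c * x / sqrt 2" by (simp add: c_def six)
    have factor: "2 * sqrt 3 / pi = sqrt 2 / c" by (simp add: c_def six)
    show ?thesis unfolding arg factor by (simp add: limit_curve_def)
  qed
  have rescale: "rescaled_boundary (lam n) x = boundary (lam n) (scale n * (c * x)) / scale n / c"
    if "1 \<le> n" for n x
  proof -
    have "sqrt (real n) = scale n * c" by (simp add: scale_def c_def real_sqrt_mult)
    then show ?thesis using part[OF that] by (simp add: rescaled_boundary_def partition_of_def mult.assoc)
  qed
  have dev: "(\<lambda>n. deviation (lam n) (scale n)) \<longlonglongrightarrow> 0"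
    by (rule deviation_tendsto_0[OF part above])
  show "uniform_limit UNIV (\<lambda>n. rescaled_boundary (lam n))
           (\<lambda>x. 2 * sqrt 3 / pi * ln (2 * cosh (pi / (2 * sqrt 3) * x))) sequentially"
  proof (rule uniform_limitI)
    fix e :: real assume e: "0 < e"
    have "0 < (c * e)\<^sup>2 / 2" using c e by simp
    from order_tendstoD(2)[OF dev this]
    show "\<forall>\<^sub>F n in sequentially. \<forall>x\<in>UNIV. dist (rescaled_boundary (lam n) x)
        (2 * sqrt 3 / pi * ln (2 * cosh (pi / (2 * sqrt 3) * x))) < e"
      using eventually_ge_at_top[of 1]
    proof eventually_elim
      case (elim n)
      show ?case
      proof
        fix x
        define d where "d = boundary (lam n) (scale n * (c * x)) / scale n - limit_curve (c * x)"
        have "d\<^sup>2 \<le> 2 * deviation (lam n) (scale n)"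
          unfolding d_def using part[OF elim(2)] scale_pos[OF elim(2)]
          by (intro boundary_close_to_limit_curve) (auto simp: partition_of_def)
        also have "\<dots> < (c * e)\<^sup>2" using elim(1) by simp
        finally have "\<bar>d\<bar> < c * e"
          using c e by (intro power2_less_imp_less[of "\<bar>d\<bar>"]) auto
        then have "\<bar>d / c\<bar> < e" using c by (simp add: abs_divide field_simps)
        moreover have "rescaled_boundary (lam n) x
            - 2 * sqrt 3 / pi * ln (2 * cosh (pi / (2 * sqrt 3) * x)) = d / c"
          unfolding rescale[OF elim(2)] limit d_def by (simp add: diff_divide_distrib)
        ultimately show "dist (rescaled_boundary (lam n) x)
            (2 * sqrt 3 / pi * ln (2 * cosh (pi / (2 * sqrt 3) * x))) < e"
          by (simp only: dist_real_def)
      qed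
    qed
  qed
qed

end
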